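(* Let $F$ be an arbitrary field, let $n\ge 4$ be an even integer, let $r=(n+2)/2$, and consider $1\le k\le r-2$. Let $B$ be the matrix associated to the kernel of the contraction map $f:\wedge^nE\to\wedge^{n-2}E$, that is, to the linear sections $\Pi_\alpha=0$, $\alpha\in I(n-2,2n)$, that define the Lagrangian-Grassmannian $L(n,2n)$ in the Grassmannian $G(n,2n)$. Then $B$ is the direct sum $$B=\mathcal L_r\oplus\Big(\bigoplus_{k=1}^{r-2}\Big(\bigoplus_{\substack{1\le a_1<\cdots<a_{2k}\le 2n\\ a_i+a_j\ne 2n+1}}\mathcal L_{k+1}^{(a_1,\ldots,a_{2k})}\Big)\Big),$$ where $\mathcal L_{k+1}^{(a_1,\ldots,a_{2k})}\cong\mathcal L_{k+1}$ (the matrices are equivalent) for $1\le k\le r-2$.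
   Context: Write $C^a_b=\binom ab$ and $I(d,N)=\{\alpha=(\alpha_1,\ldots,\alpha_d): 1\le\alpha_1<\cdots<\alpha_d\le N\}$. Contraction map. $E$ is a symplectic vector space of dimension $2n$ over $F$ with form $\langle\ ,\ \rangle$, and $f(w_1\wedge\cdots\wedge w_n)=\sum_{1\le s<t\le n}\langle w_s,w_t\rangle\, w_1\wedge\cdots\wedge\widehat{w}_s\wedge\cdots\wedge\widehat{w}_t\wedge\cdots\wedge w_n$. $G(n,2n)$ is the Grassmannian of $n$-dimensional subspaces of $E$ and $L(n,2n)=G(n,2n)\cap\mathbb P(\ker f)$ is the variety of the isotropic ones. The matrix $B$. For $\alpha\in I(n-2,2n)$ let $\Pi_\alpha=\sum_{i=1}^n c_{i,\alpha,2n-i+1}X_{i,\alpha,2n-i+1}$, a linear polynomial in the variables $X_\beta$ (Plücker coordinates), $\beta\in I(n,2n)$, where $c_{i,\alpha,2n-i+1}=1$ if the set $\{i,\alpha_1,\ldots,\alpha_{n-2},2n-i+1\}$ has exactly $n$ elements, in which case $X_{i,\alpha,2n-i+1}=X_\beta$ with $\beta$ the increasing sequence formed by this set, and $c_{i,\alpha,2n-i+1}=0$ otherwise. The equations $\Pi_\alpha=0$ are the linear system describing $\ker f$ in Plücker coordinates. $B$ is the $C^{2n}_{n-2}\times C^{2n}_n$ matrix of this system, with rows indexed by $\alpha\in I(n-2,2n)$ and columns by $\beta\in I(n,2n)$: its $(\alpha,\beta)$ entry is $1$ if $\{i,\alpha_1,\ldots,\alpha_{n-2},2n-i+1\}=\{\beta_1,\ldots,\beta_n\}$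 for some $1\le i\le n$, and $0$ otherwise. The matrices $\mathcal L_k$. Let $I_s$ be the $s\times s$ identity matrix. $M_1\sqcup\cdots\sqcup M_t$ denotes the matrix obtained by placing $M_1,\ldots,M_t$ (of non-increasing heights) side by side with their bottom rows aligned and filling the empty positions at the upper right with zeros. For a matrix $A$ with $s$ columns, $A(I_s)$ denotes $A$ with $I_s$ placed below it. For $k\ge1$ let $A^0_k=D_k\sqcup D_{k-1}\sqcup\cdots\sqcup D_1$, where $D_j$ is the $(j+1)\times j$ matrix consisting of a row of $j$ ones on top of $I_j$. For $\ell\ge0$ let $$A_k^{\ell+1}=A_k^\ell\big(I_{C^{k+\ell+1}_{\ell+2}}\big)\sqcup A_{k-1}^\ell\big(I_{C^{k+\ell}_{\ell+2}}\big)\sqcup\cdots\sqcup A_1^\ell\big(I_{C^{\ell+2}_{\ell+2}}\big).$$ For $k\ge3$, $\mathcal L_k=A_k^{k-3}$, which has $C^{2k-2}_{k-2}$ rows, $C^{2k-2}_{k-1}$ columns, $k$ ones in each row and $k-1$ ones in each column. $\mathcal L_2$ denotes the $1\times2$ matrix $(1\ \ 1)$.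
   Formalization: The block labelled (a_1,…,a_{2k}) is equivalent to L_{r-k}, not L_{k+1} (for n=6 the printed sizes give 1035 rows, but B has 495), and the 2^n zero columns of B are added as a 0×2^n summand; the direct sum is meant up to permuting rows and columns. *)

theory Defs
  imports
    "Jordan_Normal_Form.Matrix"
    "Jordan_Normal_Form.DL_Submatrix"
    "HOL-Library.Sublist"
    "HOL-Combinatorics.Permutations"
begin

section \<open>Index sets\<close>

definition idx :: "nat \<Rightarrow> nat \<Rightarrow> nat list set" where
  "idx d N = {\<alpha>. length \<alpha> = d \<and> sorted_wrt (<) \<alpha> \<and> set \<alpha> \<subseteq> {1..N}}"

text \<open>The lexicographic enumeration of \<open>idx d N\<close>, used to number rows and columns.\<close>

definition idx_list :: "nat \<Rightarrow> nat \<Rightarrow> nat list list" where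
  "idx_list d N = filter (\<lambda>\<alpha>. length \<alpha> = d) (subseqs [1..<Suc N])"

lemma set_idx_list: "set (idx_list d N) = idx d N"
proof -
  have "subseq \<alpha> [1..<Suc N] \<longleftrightarrow> sorted_wrt (<) \<alpha> \<and> set \<alpha> \<subseteq> {1..N}" for \<alpha>
  proof
    assume "subseq \<alpha> [1..<Suc N]"
    then obtain S where S: "\<alpha> = nths [1..<Suc N] S"
      by (metis subseq_conv_nths)
    have "sorted \<alpha>"
      unfolding S by (rule sorted_nths) (simp del: upt_Suc)
    moreover have "distinct \<alpha>"
      unfolding S by (rule distinct_nthsI) simp
    moreover have "set \<alpha> \<subseteq> {1..N}"
      using set_nths_subset[of "[1..<Suc N]" S] unfolding S by auto
    ultimately show "sorted_wrt (<) \<alpha> \<and> set \<alpha> \<subseteq> {1..N}"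
      by (simp add: strict_sorted_iff)
  next
    assume a: "sorted_wrt (<) \<alpha> \<and> set \<alpha> \<subseteq> {1..N}"
    have "filter (\<lambda>x. x \<in> set \<alpha>) [1..<Suc N] = \<alpha>"
    proof (rule sorted_distinct_set_unique)
      show "sorted (filter (\<lambda>x. x \<in> set \<alpha>) [1..<Suc N])"
        by (intro sorted_wrt_filter) (simp del: upt_Suc)
      show "distinct (filter (\<lambda>x. x \<in> set \<alpha>) [1..<Suc N])"
        by (intro distinct_filter distinct_upt)
      show "set (filter (\<lambda>x. x \<in> set \<alpha>) [1..<Suc N]) = set \<alpha>"
        using a by (auto simp del: upt_Suc)
    qed (use a in \<open>simp_all add: strict_sorted_iff\<close>)
    then show "subseq \<alpha> [1..<Suc N]"
      using subseq_filter_left[of "\<lambda>x. x \<in> set \<alpha>" "[1..<Suc N]"] by (simp only:)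
  qed
  then show ?thesis
    by (auto simp: idx_list_def idx_def simp del: upt_Suc)
qed

lemma distinct_idx_list: "distinct (idx_list d N)"
  unfolding idx_list_def
  using distinct_set_subseqs[of "[1..<Suc N]"] by (intro distinct_filter) (simp add: distinct_map)

lemma length_idx_list: "length (idx_list d N) = N choose d"
proof -
  have *: "length (filter (\<lambda>\<alpha>. \<alpha> = []) (subseqs xs)) = 1" for xs :: "nat list"
    by (induction xs) (auto simp: Let_def filter_map o_def)
  have "length (filter (\<lambda>\<alpha>. length \<alpha> = d) (subseqs xs)) = length xs choose d"
    for xs :: "nat list"
  proof (induction xs arbitrary: d)
    case Nil
    then show ?case by (cases d) auto
  next
    case (Cons x xs)
    then show ?case using *[of "x # xs"] by (cases d) (auto simp: Let_def filter_map o_def)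
  qed
  from this[of "[1..<Suc N]"] show ?thesis by (simp add: idx_list_def del: upt_Suc)
qed

section \<open>The linear sections and the matrix \<open>B\<close>\<close>

text \<open>A vector of the \<open>m\<close>-th exterior power of \<open>E\<close> is given by its coordinates
  \<open>X :: nat list \<Rightarrow> 'a\<close> (only the values on \<open>idx m (2*n)\<close> matter) in the basis
  \<open>e\<^sub>\<beta>\<close>, where \<open>e\<^sub>1, \<dots>, e\<^sub>2\<^sub>n\<close> is a symplectic basis of \<open>E\<close> with
  \<open>\<langle>e\<^sub>i, e\<^sub>j\<rangle> = 0\<close> unless \<open>i + j = 2 * n + 1\<close>.\<close>

definition plucker_coeff :: "nat \<Rightarrow> nat list \<Rightarrow> nat \<Rightarrow> 'a :: field" where
  "plucker_coeff n \<alpha> i = (if card ({i} \<union> set \<alpha> \<union> {2*n - i + 1}) = n then 1 else 0)"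

definition lin_section :: "nat \<Rightarrow> nat list \<Rightarrow> (nat list \<Rightarrow> 'a) \<Rightarrow> 'a :: field" where
  "lin_section n \<alpha> X =
     (\<Sum>i = 1..n. plucker_coeff n \<alpha> i * X (sorted_list_of_set ({i} \<union> set \<alpha> \<union> {2*n - i + 1})))"

definition lg_mat :: "nat \<Rightarrow> 'a :: field mat" where
  "lg_mat n = mat (2*n choose (n - 2)) (2*n choose n) (\<lambda>(p, q).
     if \<exists>i\<in>{1..n}. {i} \<union> set (idx_list (n - 2) (2*n) ! p) \<union> {2*n - i + 1} =
          set (idx_list n (2*n) ! q)
     then 1 else 0)"

definition symp_form :: "nat \<Rightarrow> nat \<Rightarrow> nat \<Rightarrow> 'a :: field" where
  "symp_form n i j = (if i + j = 2*n + 1 then if i < j then 1 else -1 else 0)"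

text \<open>The contraction map, extended linearly from the formula
  \<open>f (w\<^sub>1 \<and> \<dots> \<and> w\<^sub>n) = (\<Sum>s<t. \<langle>w\<^sub>s, w\<^sub>t\<rangle> w\<^sub>1 \<and> \<dots> (omit s, t) \<dots> \<and> w\<^sub>n)\<close> on the basis
  vectors \<open>e\<^sub>\<beta>\<close>, \<open>\<beta>\<close> increasing.  The formula carries no alternating signs (they are absorbed in
  the signs of the coordinates), so it is only meaningful on a fixed basis.\<close>

definition contraction :: "nat \<Rightarrow> (nat list \<Rightarrow> 'a) \<Rightarrow> nat list \<Rightarrow> 'a :: field" where
  "contraction n X \<alpha> =
     (\<Sum>\<beta>\<in>idx n (2*n). X \<beta> * (\<Sum>(s, t)\<in>{(s, t). s < t \<and> t < n}.
        if nths \<beta> (- {s, t}) = \<alpha> then symp_form n (\<beta> ! s) (\<beta> ! t) else 0))"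

lemma card_idx: "\<alpha> \<in> idx d N \<Longrightarrow> card (set \<alpha>) = d"
  by (auto simp: idx_def strict_sorted_iff distinct_card)

lemma finite_idx: "finite (idx d N)"
  using set_idx_list by (metis List.finite_set)

lemma lin_section_eq_sum:
  assumes n: "n \<ge> 2" and \<alpha>: "\<alpha> \<in> idx (n - 2) (2*n)"
  shows "lin_section n \<alpha> X = (\<Sum>\<beta>\<in>idx n (2*n).
    (if \<exists>i\<in>{1..n}. {i} \<union> set \<alpha> \<union> {2*n - i + 1} = set \<beta> then 1 else 0) * X \<beta>)"
proof -
  let ?S = "\<lambda>i. {i} \<union> set \<alpha> \<union> {2*n - i + 1}"
  let ?b = "\<lambda>i. sorted_list_of_set (?S i)"
  let ?I = "{i \<in> {1..n}. card (?S i) = n}"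
  have "lin_section n \<alpha> X = (\<Sum>i\<in>?I. X (?b i))"
    unfolding lin_section_def plucker_coeff_def
    by (subst sum.inter_filter) (auto intro!: sum.cong)
  also have "\<dots> = (\<Sum>\<beta>\<in>?b ` ?I. X \<beta>)"
  proof (rule sum.reindex_cong[symmetric, where l = ?b])
    show "inj_on ?b ?I"
    proof (rule inj_onI)
      fix i j assume ij: "i \<in> ?I" "j \<in> ?I" "?b i = ?b j"
      have "set (?b i) = set (?b j)" by (rule arg_cong[OF ij(3)])
      then have eq: "?S i = ?S j"
        by (subst (asm) (1 2) sorted_list_of_set.set_sorted_key_list_of_set) simp_all
      have "i \<notin> set \<alpha>"
      proof
        assume "i \<in> set \<alpha>"
        then have "?S i = insert (2*n - i + 1) (set \<alpha>)" by auto
        then have "card (?S i) \<le> Suc (n - 2)"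
          by (simp add: card_insert_if card_idx[OF \<alpha>])
        then show False using ij n by auto
      qed
      then have "i = j \<or> i = 2*n - j + 1" using eq by auto
      then show "i = j" using ij by auto
    qed
  qed auto
  also have "?b ` ?I = {\<beta> \<in> idx n (2*n). \<exists>i\<in>{1..n}. ?S i = set \<beta>}"
  proof (intro equalityI subsetI)
    fix \<beta> assume "\<beta> \<in> ?b ` ?I"
    then obtain i where i: "i \<in> ?I" "\<beta> = ?b i" by blast
    have "set \<beta> = ?S i"
      unfolding i(2) by (rule sorted_list_of_set.set_sorted_key_list_of_set) simp
    moreover have "?S i \<subseteq> {1..2*n}" using i \<alpha> by (auto simp: idx_def)
    moreover have "length \<beta> = n"
      unfolding i(2) sorted_list_of_set.length_sorted_key_list_of_set using i(1) by blast
    moreover have "sorted_wrt (<) \<beta>"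
      unfolding i(2) by (rule sorted_list_of_set.strict_sorted_key_list_of_set)
    ultimately have "\<beta> \<in> idx n (2*n)" "?S i = set \<beta>"
      unfolding idx_def by blast+
    then show "\<beta> \<in> {\<beta> \<in> idx n (2*n). \<exists>i\<in>{1..n}. ?S i = set \<beta>}"
      using i(1) by blast
  next
    fix \<beta> assume "\<beta> \<in> {\<beta> \<in> idx n (2*n). \<exists>i\<in>{1..n}. ?S i = set \<beta>}"
    then obtain i where i: "i \<in> {1..n}" "?S i = set \<beta>" and \<beta>: "\<beta> \<in> idx n (2*n)" by blast
    have "\<beta> = ?b i" unfolding i(2) using \<beta>
      by (simp add: idx_def sorted_list_of_set.idem_if_sorted_distinct strict_sorted_iff)
    moreover have "i \<in> ?I" using i card_idx[OF \<beta>] by simp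
    ultimately show "\<beta> \<in> ?b ` ?I" by blast
  qed
  also have "(\<Sum>\<beta>\<in>{\<beta> \<in> idx n (2*n). \<exists>i\<in>{1..n}. ?S i = set \<beta>}. X \<beta>) =
    (\<Sum>\<beta>\<in>idx n (2*n). (if \<exists>i\<in>{1..n}. ?S i = set \<beta> then 1 else 0) * X \<beta>)"
    by (subst sum.inter_filter) (auto simp: finite_idx intro!: sum.cong)
  finally show ?thesis .
qed

text \<open>\<open>B\<close> is the coefficient matrix of the system \<open>\<Pi>\<^sub>\<alpha> = 0\<close>, and this system describes the kernel
  of the contraction.\<close>

lemma lg_mat_mult_vec:
  assumes n: "n \<ge> 2" and p: "p < 2*n choose (n - 2)"
  shows "(lg_mat n *\<^sub>v vec (2*n choose n) (\<lambda>q. X (idx_list n (2*n) ! q))) $ p =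
    lin_section n (idx_list (n - 2) (2*n) ! p) X"
proof -
  let ?\<alpha> = "idx_list (n - 2) (2*n) ! p"
  let ?g = "\<lambda>\<beta>. (if \<exists>i\<in>{1..n}. {i} \<union> set ?\<alpha> \<union> {2*n - i + 1} = set \<beta> then 1 else 0) * X \<beta>"
  have \<alpha>: "?\<alpha> \<in> idx (n - 2) (2*n)"
    using p by (metis length_idx_list nth_mem set_idx_list)
  have "(lg_mat n *\<^sub>v vec (2*n choose n) (\<lambda>q. X (idx_list n (2*n) ! q))) $ p =
    (\<Sum>q<2*n choose n. ?g (idx_list n (2*n) ! q))"
    using p by (simp add: lg_mat_def scalar_prod_def atLeast0LessThan)
  also have "\<dots> = (\<Sum>\<beta>\<in>idx n (2*n). ?g \<beta>)"
    by (rule sum.reindex_bij_betw)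
      (metis bij_betw_nth distinct_idx_list length_idx_list set_idx_list)
  also have "\<dots> = lin_section n ?\<alpha> X"
    by (rule lin_section_eq_sum[OF n \<alpha>, symmetric])
  finally show ?thesis .
qed

lemma contraction_eq_lin_section:
  assumes n: "n \<ge> 2" and \<alpha>: "\<alpha> \<in> idx (n - 2) (2*n)"
  shows "contraction n X \<alpha> = lin_section n \<alpha> X"
proof -
  have "(\<Sum>(s, t)\<in>{(s, t). s < t \<and> t < n}.
          if nths \<beta> (- {s, t}) = \<alpha> then symp_form n (\<beta> ! s) (\<beta> ! t) else 0) =
        (if \<exists>i\<in>{1..n}. {i} \<union> set \<alpha> \<union> {2*n - i + 1} = set \<beta> then 1 else (0 :: 'a))"
    (is "(\<Sum>(s, t)\<in>?P. ?f s t) = ?rhs")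
    if \<beta>: "\<beta> \<in> idx n (2*n)" for \<beta>
  proof -
    have len: "length \<beta> = n" and srt: "sorted_wrt (<) \<beta>" and rng: "set \<beta> \<subseteq> {1..2*n}"
      using \<beta> by (auto simp: idx_def)
    have dist: "distinct \<beta>" using srt by (simp add: strict_sorted_iff)
    have fin: "finite ?P" by (rule finite_subset[of _ "{..<n} \<times> {..<n}"]) auto
    have setn: "set (nths \<beta> (- {s, t})) = set \<beta> - {\<beta> ! s, \<beta> ! t}" if "s < t" "t < n" for s t
    proof (intro equalityI subsetI)
      fix x assume "x \<in> set (nths \<beta> (- {s, t}))"
      then obtain u where "x = \<beta> ! u" "u < n" "u \<noteq> s" "u \<noteq> t"
        unfolding set_nths len by blast
      then show "x \<in> set \<beta> - {\<beta> ! s, \<beta> ! t}"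
        using that len dist by (simp add: nth_eq_iff_index_eq)
    next
      fix x assume x: "x \<in> set \<beta> - {\<beta> ! s, \<beta> ! t}"
      then obtain u where u: "x = \<beta> ! u" "u < n"
        using len by (metis DiffD1 in_set_conv_nth)
      then have "u \<noteq> s" "u \<noteq> t" using x by blast+
      then show "x \<in> set (nths \<beta> (- {s, t}))"
        using u unfolding set_nths len by blast
    qed
    have nths_eq: "nths \<beta> (- {s, t}) = \<alpha> \<longleftrightarrow> set \<beta> - {\<beta> ! s, \<beta> ! t} = set \<alpha>"
      if "s < t" "t < n" for s t
    proof -
      have "sorted (nths \<beta> (- {s, t}))" "distinct (nths \<beta> (- {s, t}))"
        using srt by (auto simp: strict_sorted_iff intro: sorted_nths distinct_nthsI)
      moreover have "sorted \<alpha>" "distinct \<alpha>"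
        using \<alpha> by (simp_all add: idx_def strict_sorted_iff)
      ultimately have "nths \<beta> (- {s, t}) = \<alpha> \<longleftrightarrow> set (nths \<beta> (- {s, t})) = set \<alpha>"
        using sorted_distinct_set_unique by blast
      then show ?thesis unfolding setn[OF that] .
    qed
    have lt: "\<beta> ! s < \<beta> ! t" if "s < t" "t < n" for s t
      using that srt len by (simp add: sorted_wrt_iff_nth_less)
    have f: "?f s t =
        (if set \<beta> - {\<beta> ! s, \<beta> ! t} = set \<alpha> \<and> \<beta> ! s + \<beta> ! t = 2*n + 1 then 1 else 0)"
      if "s < t" "t < n" for s t
      using nths_eq[OF that] lt[OF that] by (simp add: symp_form_def)
    show ?thesis
    proof (cases "\<exists>i\<in>{1..n}. {i} \<union> set \<alpha> \<union> {2*n - i + 1} = set \<beta>")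
      case True
      then obtain i where i: "i \<in> {1..n}" "{i} \<union> set \<alpha> \<union> {2*n - i + 1} = set \<beta>" by blast
      let ?j = "2*n - i + 1"
      have ij: "i < ?j" using i(1) by auto
      have notin: "i \<notin> set \<alpha>" "?j \<notin> set \<alpha>"
      proof -
        have c: "card (set \<alpha> \<union> {i, ?j}) = n"
        proof -
          have "set \<alpha> \<union> {i, ?j} = set \<beta>" unfolding i(2)[symmetric] by blast
          then show ?thesis using card_idx[OF \<beta>] by argo
        qed
        have c1: "card (insert x (set \<alpha>)) \<noteq> n" for x
          by (cases "x \<in> set \<alpha>") (use card_idx[OF \<alpha>] n in \<open>simp_all add: insert_absorb\<close>)
        show "i \<notin> set \<alpha>"
        proof
          assume "i \<in> set \<alpha>"
          then have "set \<alpha> \<union> {i, ?j} = insert ?j (set \<alpha>)" by blast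
          then show False using c c1[of ?j] by argo
        qed
        show "?j \<notin> set \<alpha>"
        proof
          assume "?j \<in> set \<alpha>"
          then have "set \<alpha> \<union> {i, ?j} = insert i (set \<alpha>)" by blast
          then show False using c c1[of i] by argo
        qed
      qed
      have diff: "set \<beta> - {i, ?j} = set \<alpha>"
        unfolding i(2)[symmetric] using notin by blast
      have "i \<in> set \<beta>" "?j \<in> set \<beta>" unfolding i(2)[symmetric] by simp_all
      then obtain s t where s: "s < n" "\<beta> ! s = i" and t: "t < n" "\<beta> ! t = ?j"
        unfolding in_set_conv_nth len by blast
      have st: "s < t"
        using s t ij lt[of t s] by (cases s t rule: linorder_cases) auto
      have key: "?f s' t' = (if (s', t') = (s, t) then 1 else 0)" if "s' < t'" "t' < n" for s' t'
      proof (cases "(s', t') = (s, t)")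
        case True
        have "set \<beta> - {\<beta> ! s, \<beta> ! t} = set \<alpha>" "\<beta> ! s + \<beta> ! t = 2*n + 1"
          unfolding s(2) t(2) using diff i(1) by auto
        then have "?f s t = 1" unfolding f[OF st t(1)] by (simp only: simp_thms if_True)
        moreover have "s' = s" "t' = t" using True by simp_all
        ultimately show ?thesis by (simp only: simp_thms if_True)
      next
        case False
        have "set \<beta> - {\<beta> ! s', \<beta> ! t'} \<noteq> set \<alpha>"
        proof
          assume e: "set \<beta> - {\<beta> ! s', \<beta> ! t'} = set \<alpha>"
          have "\<beta> ! s \<notin> set \<alpha>" "\<beta> ! t \<notin> set \<alpha>" using s t notin by auto
          moreover have "\<beta> ! s \<in> set \<beta>" "\<beta> ! t \<in> set \<beta>"
            using s(1) t(1) len by (simp_all only: nth_mem)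
          ultimately have "\<beta> ! s \<in> {\<beta> ! s', \<beta> ! t'}" "\<beta> ! t \<in> {\<beta> ! s', \<beta> ! t'}"
            using e by blast+
          then have "s \<in> {s', t'}" "t \<in> {s', t'}"
            using dist len s t that by (auto simp: nth_eq_iff_index_eq)
          then show False using st that False by auto
        qed
        then have "?f s' t' = 0" unfolding f[OF that] by (simp only: simp_thms if_False)
        then show ?thesis using False by argo
      qed
      have "(\<Sum>(s', t')\<in>?P. ?f s' t') = (\<Sum>x\<in>?P. if x = (s, t) then 1 else 0)"
      proof (rule sum.cong[OF refl])
        fix x assume "x \<in> ?P"
        then obtain s' t' where x: "x = (s', t')" and "s' < t'" "t' < n" by blast
        then show "(case x of (s', t') \<Rightarrow> ?f s' t') = (if x = (s, t) then 1 else 0)"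
          unfolding x prod.case by (intro key)
      qed
      also have "\<dots> = 1" using st t(1) by (subst sum.delta[OF fin]) simp
      finally show ?thesis using True by simp
    next
      case False
      have "?f s t = 0" if "s < t" "t < n" for s t
      proof -
        have "\<not> (set \<beta> - {\<beta> ! s, \<beta> ! t} = set \<alpha> \<and> \<beta> ! s + \<beta> ! t = 2*n + 1)"
        proof
          assume e: "set \<beta> - {\<beta> ! s, \<beta> ! t} = set \<alpha> \<and> \<beta> ! s + \<beta> ! t = 2*n + 1"
          have m: "\<beta> ! s \<in> set \<beta>" "\<beta> ! t \<in> set \<beta>" using that len by auto
          then have "\<beta> ! s \<in> {1..n}" "\<beta> ! t = 2*n - \<beta> ! s + 1"
            using rng e lt[OF that] by auto
          moreover have "{\<beta> ! s} \<union> set \<alpha> \<union> {\<beta> ! t} = set \<beta>" using e m by blast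
          moreover have "{\<beta> ! s} \<union> set \<alpha> \<union> {2*n - \<beta> ! s + 1} = set \<beta>"
            using calculation by argo
          ultimately show False using False by blast
        qed
        then show ?thesis unfolding f[OF that] by (simp only: if_False)
      qed
      then have "(\<Sum>(s, t)\<in>?P. ?f s t) = 0" by (intro sum.neutral) auto
      then show ?thesis using False by simp
    qed
  qed
  then show ?thesis
    unfolding contraction_def lin_section_eq_sum[OF n \<alpha>]
    by (intro sum.cong) (simp_all add: mult.commute)
qed

lemma contraction_kernel:
  assumes n: "n \<ge> 2"
  shows "(\<forall>\<alpha>\<in>idx (n - 2) (2*n). contraction n X \<alpha> = 0) \<longleftrightarrow>
    lg_mat n *\<^sub>v vec (2*n choose n) (\<lambda>q. X (idx_list n (2*n) ! q)) = 0\<^sub>v (2*n choose (n - 2))"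
    (is "_ \<longleftrightarrow> ?v = _")
proof -
  have "?v = 0\<^sub>v (2*n choose (n - 2)) \<longleftrightarrow> (\<forall>p<2*n choose (n - 2). ?v $ p = 0)"
    by (auto simp: vec_eq_iff lg_mat_def)
  also have "\<dots> \<longleftrightarrow>
      (\<forall>p<2*n choose (n - 2). lin_section n (idx_list (n - 2) (2*n) ! p) X = 0)"
    using lg_mat_mult_vec[OF n] by metis
  also have "\<dots> \<longleftrightarrow> (\<forall>\<alpha>\<in>set (idx_list (n - 2) (2*n)). lin_section n \<alpha> X = 0)"
    by (simp add: all_set_conv_all_nth length_idx_list)
  also have "\<dots> \<longleftrightarrow> (\<forall>\<alpha>\<in>idx (n - 2) (2*n). contraction n X \<alpha> = 0)"
    by (simp add: set_idx_list contraction_eq_lin_section[OF n])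
  finally show ?thesis by simp
qed

section \<open>The matrices \<open>\<L>\<^sub>k\<close>\<close>

text \<open>\<open>M \<squnion> N\<close>: side by side, bottom rows aligned.  The empty matrix \<open>0\<^sub>m 0 0\<close> is a right unit.\<close>

definition bottom_join :: "'a :: zero mat \<Rightarrow> 'a mat \<Rightarrow> 'a mat" where
  "bottom_join M N = mat (dim_row M) (dim_col M + dim_col N) (\<lambda>(i, j).
     if j < dim_col M then M $$ (i, j)
     else if i < dim_row M - dim_row N then 0
     else N $$ (i - (dim_row M - dim_row N), j - dim_col M))"

definition bottom_joins :: "'a :: zero mat list \<Rightarrow> 'a mat" where
  "bottom_joins Ms = foldr bottom_join Ms (0\<^sub>m 0 0)"

definition D_mat :: "nat \<Rightarrow> 'a :: field mat" where
  "D_mat j = mat 1 j (\<lambda>_. 1) @\<^sub>r 1\<^sub>m j"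

fun A_mat :: "nat \<Rightarrow> nat \<Rightarrow> 'a :: field mat" where
  "A_mat 0 k = bottom_joins (map D_mat (rev [1..<Suc k]))"
| "A_mat (Suc l) k = bottom_joins
     (map (\<lambda>j. A_mat l j @\<^sub>r 1\<^sub>m ((j + l + 1) choose (l + 2))) (rev [1..<Suc k]))"

text \<open>Only used for \<open>k \<ge> 2\<close>.\<close>

definition L_mat :: "nat \<Rightarrow> 'a :: field mat" where
  "L_mat k = (if k = 2 then mat 1 2 (\<lambda>_. 1) else A_mat (k - 3) k)"

section \<open>Equivalence and the blocks of \<open>B\<close>\<close>

text \<open>Equivalence by permutations of rows and columns; in particular \<open>M = P * N * Q\<close> with
  permutation matrices \<open>P\<close>, \<open>Q\<close>.\<close>

definition mat_equiv :: "'a mat \<Rightarrow> 'a mat \<Rightarrow> bool" (infix \<open>\<cong>\<^sub>m\<close> 50) where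
  "M \<cong>\<^sub>m N \<longleftrightarrow> dim_row M = dim_row N \<and> dim_col M = dim_col N \<and>
     (\<exists>p q. p permutes {..<dim_row M} \<and> q permutes {..<dim_col M} \<and>
        (\<forall>i<dim_row M. \<forall>j<dim_col M. M $$ (p i, q j) = N $$ (i, j)))"

text \<open>The entries of a multi-index whose partner under \<open>x \<mapsto> 2 * n + 1 - x\<close> is absent.\<close>

definition unpaired :: "nat \<Rightarrow> nat list \<Rightarrow> nat list" where
  "unpaired n \<alpha> = filter (\<lambda>x. 2*n + 1 - x \<notin> set \<alpha>) \<alpha>"

definition labels :: "nat \<Rightarrow> nat \<Rightarrow> nat list list" where
  "labels n k = filter (\<lambda>a. \<forall>x\<in>set a. \<forall>y\<in>set a. x + y \<noteq> 2*n + 1) (idx_list (2*k) (2*n))"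

text \<open>The block with superscript \<open>a = (a\<^sub>1, \<dots>, a\<^sub>2\<^sub>k)\<close>: the submatrix of \<open>B\<close> on the rows and
  columns whose multi-index has unpaired part \<open>a\<close>.  For a label \<open>a\<close> of length \<open>2 * k\<close> it has
  \<open>(n - 2*k) choose (n div 2 - k - 1)\<close> rows, as \<open>\<L>\<^sub>m\<close> has for \<open>m = (n + 2) div 2 - k\<close>.
  The \<open>2 ^ n\<close> columns of \<open>B\<close> with nothing but unpaired entries are zero; in a direct sum they
  appear as the summand \<open>0\<^sub>m 0 (2 ^ n)\<close>.\<close>

definition L_block :: "nat \<Rightarrow> nat list \<Rightarrow> 'a :: field mat" where
  "L_block n a = submatrix (lg_mat n)
     {p. unpaired n (idx_list (n - 2) (2*n) ! p) = a}
     {q. unpaired n (idx_list n (2*n) ! q) = a}"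

end

theory Submission
  imports Defs
begin

text \<open>The multiplication by a pair \<open>e\<^sub>i \<and> e\<^sub>j\<close>, \<open>i + j = 2 * n + 1\<close>, does not change the unpaired part of
  a multi-index, so \<open>B\<close> splits into blocks indexed by the possible unpaired parts \<open>a\<close>.  Multi-indices
  with unpaired part \<open>a\<close> correspond to subsets of the set of \<open>n - length a = 2 * s\<close> pairs avoiding
  \<open>a\<close>, and in these terms the block is the inclusion matrix of \<open>(s - 1)\<close>-subsets versus
  \<open>s\<close>-subsets.  The recursion defining \<open>\<L>\<^sub>s\<^sub>+\<^sub>1\<close> is the recursion for the same inclusion matrix,
  with subsets enumerated lexicographically, obtained by separating off the first element.\<close>

section \<open>Matrices up to relabelling of rows and columns\<close>

text \<open>Hiding the numberings of rows and columns behind existential bijections determines a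
  matrix only up to permutations, so that decompositions can be argued on sets of labels instead of
  positions.\<close>

definition represents ::
    "'a mat \<Rightarrow> 'r set \<Rightarrow> 'c set \<Rightarrow> ('r \<Rightarrow> 'c \<Rightarrow> 'a) \<Rightarrow> bool" where
  "represents M R C f \<longleftrightarrow> (\<exists>\<rho> \<gamma>. bij_betw \<rho> {..<dim_row M} R \<and> bij_betw \<gamma> {..<dim_col M} C \<and>
     (\<forall>i<dim_row M. \<forall>j<dim_col M. M $$ (i, j) = f (\<rho> i) (\<gamma> j)))"

lemma representsI:
  assumes "bij_betw \<rho> {..<dim_row M} R" "bij_betw \<gamma> {..<dim_col M} C"
    and "\<And>i j. i < dim_row M \<Longrightarrow> j < dim_col M \<Longrightarrow> M $$ (i, j) = f (\<rho> i) (\<gamma> j)"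
  shows "represents M R C f"
  unfolding represents_def using assms by blast

text \<open>Two numberings of one set differ by a permutation: apply \<open>\<rho>'\<close>, then
  the inverse of \<open>\<rho>\<close>.\<close>

lemma permutes_of_bij_betw:
  fixes \<rho> \<rho>' :: "nat \<Rightarrow> 'r"
  assumes "bij_betw \<rho> {..<m} R" "bij_betw \<rho>' {..<m} R"
  obtains p where "p permutes {..<m}" "\<And>i. i < m \<Longrightarrow> \<rho> (p i) = \<rho>' i"
proof
  define q where "q = (\<lambda>i. inv_into {..<m} \<rho> (\<rho>' i))"
  \<comment> \<open>\<open>permutes\<close> demands the identity outside
    \<open>{..<m}\<close>.\<close>
  let ?p = "\<lambda>i. if i \<in> {..<m} then q i else i"
  have "bij_betw q {..<m} {..<m}"
    using bij_betw_trans[OF assms(2) bij_betw_inv_into[OF assms(1)]]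
    by (simp add: q_def o_def)
  then have "bij_betw ?p {..<m} {..<m}"
    by (subst bij_betw_cong[where g = q]) auto
  then show "?p permutes {..<m}"
    by (rule bij_imp_permutes) simp
  fix i assume i: "i < m"
  then have "\<rho>' i \<in> \<rho> ` {..<m}"
    using assms by (auto simp: bij_betw_def)
  then show "\<rho> (?p i) = \<rho>' i"
    using i by (simp add: q_def f_inv_into_f)
qed

text \<open>Comparing the numberings of common label sets supplies both permutations. Both claims of
  the theorem are concluded through this lemma.\<close>

lemma mat_equiv_if_represents:
  assumes "represents M R C f" "represents N R C f"
  shows "M \<cong>\<^sub>m N"
proof -
  obtain \<rho> \<gamma> where M: "bij_betw \<rho> {..<dim_row M} R" "bij_betw \<gamma> {..<dim_col M} C"
    "\<And>i j. i < dim_row M \<Longrightarrow> j < dim_col M \<Longrightarrow> M $$ (i, j) = f (\<rho> i) (\<gamma> j)"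
    using assms(1) unfolding represents_def by blast
  obtain \<rho>' \<gamma>' where N: "bij_betw \<rho>' {..<dim_row N} R" "bij_betw \<gamma>' {..<dim_col N} C"
    "\<And>i j. i < dim_row N \<Longrightarrow> j < dim_col N \<Longrightarrow> N $$ (i, j) = f (\<rho>' i) (\<gamma>' j)"
    using assms(2) unfolding represents_def by blast
  have dims: "dim_row M = dim_row N" "dim_col M = dim_col N"
    using bij_betw_same_card[OF M(1)] bij_betw_same_card[OF M(2)]
      bij_betw_same_card[OF N(1)] bij_betw_same_card[OF N(2)] by simp_all
  obtain p where p: "p permutes {..<dim_row M}" "\<And>i. i < dim_row M \<Longrightarrow> \<rho> (p i) = \<rho>' i"
    using permutes_of_bij_betw[OF M(1)] N(1) unfolding dims by metis
  obtain q where q: "q permutes {..<dim_col M}" "\<And>i. i < dim_col M \<Longrightarrow> \<gamma> (q i) = \<gamma>' i"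
    using permutes_of_bij_betw[OF M(2)] N(2) unfolding dims by metis
  have "M $$ (p i, q j) = N $$ (i, j)" if "i < dim_row M" "j < dim_col M" for i j
  proof -
    have "p i < dim_row M" "q j < dim_col M"
      using permutes_in_image[OF p(1)] permutes_in_image[OF q(1)] that by simp_all
    then show ?thesis
      using that M(3) N(3) p(2) q(2) dims by simp
  qed
  then show ?thesis
    unfolding mat_equiv_def using p(1) q(1) dims by blast
qed

lemma represents_reindex:
  assumes "represents M R C f" "bij_betw h R R'" "bij_betw g C C'"
    and "\<And>x y. x \<in> R \<Longrightarrow> y \<in> C \<Longrightarrow> f' (h x) (g y) = f x y"
  shows "represents M R' C' f'"
proof -
  obtain \<rho> \<gamma> where M: "bij_betw \<rho> {..<dim_row M} R" "bij_betw \<gamma> {..<dim_col M} C"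
    "\<And>i j. i < dim_row M \<Longrightarrow> j < dim_col M \<Longrightarrow> M $$ (i, j) = f (\<rho> i) (\<gamma> j)"
    using assms(1) unfolding represents_def by blast
  show ?thesis
  proof (rule representsI)
    show "bij_betw (h \<circ> \<rho>) {..<dim_row M} R'" "bij_betw (g \<circ> \<gamma>) {..<dim_col M} C'"
      using bij_betw_trans M assms by blast+
    fix i j assume ij: "i < dim_row M" "j < dim_col M"
    then have "\<rho> i \<in> R" "\<gamma> j \<in> C"
      using M by (auto simp: bij_betw_def)
    then show "M $$ (i, j) = f' ((h \<circ> \<rho>) i) ((g \<circ> \<gamma>) j)"
      using ij M(3) assms(4) by simp
  qed
qed

lemma represents_mat:
  assumes "distinct rs" "distinct cs"
  shows "represents (mat (length rs) (length cs) (\<lambda>(i, j). f (rs ! i) (cs ! j)))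
    (set rs) (set cs) f"
  by (rule representsI[of "(!) rs" _ _ "(!) cs"]) (use assms in \<open>auto intro!: bij_betw_nth\<close>)

section \<open>Submatrices cut out by a property of the labels\<close>

lemma bij_betw_pick:
  "bij_betw (pick I) {..<card {i. i < m \<and> i \<in> I}} {i. i < m \<and> i \<in> I}"
proof -
  \<comment> \<open>\<open>I\<close> may reach beyond \<open>m\<close>. In the range considered,
    \<open>pick I\<close> agrees with \<open>pick ?S\<close>, which is strictly increasing and hence
    onto the finite set \<open>?S\<close> by counting.\<close>
  let ?S = "{i. i < m \<and> i \<in> I}"
  have "inj_on (pick ?S) {..<card ?S}"
  proof (rule linorder_inj_onI)
    fix x y assume "x < y" "y \<in> {..<card ?S}"
    then show "pick ?S x \<noteq> pick ?S y"
      using pick_mono_le[of y ?S x] by simp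
  qed (simp add: linear)
  moreover have "pick ?S ` {..<card ?S} \<subseteq> ?S"
    using pick_in_set_le by blast
  ultimately have "bij_betw (pick ?S) {..<card ?S} ?S"
    unfolding bij_betw_def by (intro conjI card_subset_eq) (simp_all add: card_image)
  then show ?thesis
    by (subst bij_betw_cong[where g = "pick ?S"]) (simp_all add: pick_reduce_set)
qed

lemma bij_betw_nth_pick:
  assumes "distinct xs"
  shows "bij_betw ((!) xs \<circ> pick {p. P (xs ! p)})
    {..<card {i. i < length xs \<and> i \<in> {p. P (xs ! p)}}} {x \<in> set xs. P x}"
proof (rule bij_betw_trans[OF bij_betw_pick])
  show "bij_betw ((!) xs) {i. i < length xs \<and> i \<in> {p. P (xs ! p)}} {x \<in> set xs. P x}"
    using assms by (auto simp: bij_betw_def inj_on_def nth_eq_iff_index_eq in_set_conv_nth)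
qed

lemma represents_submatrix:
  assumes "distinct rs" "distinct cs"
  shows "represents (submatrix (mat (length rs) (length cs) (\<lambda>(i, j). f (rs ! i) (cs ! j)))
      {p. P (rs ! p)} {q. Q (cs ! q)})
    {r \<in> set rs. P r} {c \<in> set cs. Q c} f"
proof -
  show ?thesis
  proof (rule representsI)
    fix i j
    assume "i < dim_row (submatrix (mat (length rs) (length cs) (\<lambda>(i, j). f (rs ! i) (cs ! j)))
        {p. P (rs ! p)} {q. Q (cs ! q)})"
      and "j < dim_col (submatrix (mat (length rs) (length cs) (\<lambda>(i, j). f (rs ! i) (cs ! j)))
        {p. P (rs ! p)} {q. Q (cs ! q)})"
    then show "submatrix (mat (length rs) (length cs) (\<lambda>(i, j). f (rs ! i) (cs ! j)))
        {p. P (rs ! p)} {q. Q (cs ! q)} $$ (i, j) =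
      f (((!) rs \<circ> pick {p. P (rs ! p)}) i) (((!) cs \<circ> pick {q. Q (cs ! q)}) j)"
      by (simp add: dim_submatrix submatrix_index pick_le)
  qed (use bij_betw_nth_pick[OF assms(1), of P] bij_betw_nth_pick[OF assms(2), of Q]
      in \<open>simp_all add: dim_submatrix o_def\<close>)
qed

section \<open>Block-diagonal matrices\<close>

lemma bij_betw_shift_Un:
  fixes m l :: nat
  assumes "bij_betw f {..<m} A" "bij_betw g {..<l} B" "A \<inter> B = {}"
  shows "bij_betw (\<lambda>i. if i < m then f i else g (i - m)) {..<m + l} (A \<union> B)"
proof -
  have s: "bij_betw (\<lambda>i. i - m) {m..<m + l} {..<l}"
    by (rule bij_betw_byWitness[where f' = "\<lambda>i. i + m"]) auto
  have "bij_betw (\<lambda>i. if i < m then f i else g (i - m)) {..<m} A"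
    using assms(1) by (subst bij_betw_cong[where g = f]) auto
  moreover have "bij_betw (\<lambda>i. if i < m then f i else g (i - m)) {m..<m + l} B"
    using bij_betw_trans[OF s assms(2)]
    by (subst bij_betw_cong[where g = "g \<circ> (\<lambda>i. i - m)"]) auto
  moreover have "{..<m + l} = {..<m} \<union> {m..<m + l}"
    by auto
  ultimately show ?thesis
    using assms(3) by (simp only:) (rule bij_betw_combine)
qed

lemma represents_four_block:
  assumes A: "represents A R C f" and B: "represents B R' C' f"
    and "R \<inter> R' = {}" "C \<inter> C' = {}"
    and z: "\<And>x y. x \<in> R \<Longrightarrow> y \<in> C' \<Longrightarrow> f x y = 0" "\<And>x y. x \<in> R' \<Longrightarrow> y \<in> C \<Longrightarrow> f x y = 0"
  shows "represents (four_block_mat A (0\<^sub>m (dim_row A) (dim_col B)) (0\<^sub>m (dim_row B) (dim_col A)) B)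
    (R \<union> R') (C \<union> C') f"
proof -
  obtain \<rho> \<gamma> where \<rho>: "bij_betw \<rho> {..<dim_row A} R" and \<gamma>: "bij_betw \<gamma> {..<dim_col A} C"
    and eA: "\<And>i j. i < dim_row A \<Longrightarrow> j < dim_col A \<Longrightarrow> A $$ (i, j) = f (\<rho> i) (\<gamma> j)"
    using A unfolding represents_def by blast
  obtain \<rho>' \<gamma>' where \<rho>': "bij_betw \<rho>' {..<dim_row B} R'" and \<gamma>': "bij_betw \<gamma>' {..<dim_col B} C'"
    and eB: "\<And>i j. i < dim_row B \<Longrightarrow> j < dim_col B \<Longrightarrow> B $$ (i, j) = f (\<rho>' i) (\<gamma>' j)"
    using B unfolding represents_def by blast
  have m: "\<And>i. i < dim_row A \<Longrightarrow> \<rho> i \<in> R" "\<And>i. i < dim_col A \<Longrightarrow> \<gamma> i \<in> C"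
    "\<And>i. i < dim_row B \<Longrightarrow> \<rho>' i \<in> R'" "\<And>i. i < dim_col B \<Longrightarrow> \<gamma>' i \<in> C'"
    using \<rho> \<gamma> \<rho>' \<gamma>' by (auto simp: bij_betw_def)
  show ?thesis
  proof (rule representsI)
    show "bij_betw (\<lambda>i. if i < dim_row A then \<rho> i else \<rho>' (i - dim_row A))
      {..<dim_row (four_block_mat A (0\<^sub>m (dim_row A) (dim_col B)) (0\<^sub>m (dim_row B) (dim_col A)) B)}
      (R \<union> R')"
      using bij_betw_shift_Un[OF \<rho> \<rho>' assms(3)] by simp
    show "bij_betw (\<lambda>i. if i < dim_col A then \<gamma> i else \<gamma>' (i - dim_col A))
      {..<dim_col (four_block_mat A (0\<^sub>m (dim_row A) (dim_col B)) (0\<^sub>m (dim_row B) (dim_col A)) B)}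
      (C \<union> C')"
      using bij_betw_shift_Un[OF \<gamma> \<gamma>' assms(4)] by simp
  qed (auto simp: eA eB m z)
qed

text \<open>The keys colour rows and columns, and \<open>f\<close> vanishes where colours differ;
  induction on the list of colours adds one diagonal block at a time. Separate keys for rows and
  columns allow a colour that no row has, hence blocks without rows.\<close>

lemma represents_diag_block_mat:
  assumes "distinct xs"
    and "\<And>x. x \<in> set xs \<Longrightarrow> represents (M x) {r \<in> R. \<kappa> r = x} {c \<in> C. \<kappa>' c = x} f"
    and "\<And>r c. r \<in> R \<Longrightarrow> c \<in> C \<Longrightarrow> \<kappa> r \<noteq> \<kappa>' c \<Longrightarrow> f r c = 0"
  shows "represents (diag_block_mat (map M xs)) {r \<in> R. \<kappa> r \<in> set xs} {c \<in> C. \<kappa>' c \<in> set xs} f"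
  using assms(1,2)
proof (induction xs)
  case Nil
  show ?case by (rule representsI) (auto simp: bij_betw_def)
next
  case (Cons x xs)
  let ?D = "diag_block_mat (map M xs)"
  have "represents (four_block_mat (M x) (0\<^sub>m (dim_row (M x)) (dim_col ?D))
      (0\<^sub>m (dim_row ?D) (dim_col (M x))) ?D)
    ({r \<in> R. \<kappa> r = x} \<union> {r \<in> R. \<kappa> r \<in> set xs})
    ({c \<in> C. \<kappa>' c = x} \<union> {c \<in> C. \<kappa>' c \<in> set xs}) f"
  proof (rule represents_four_block)
    show "represents (M x) {r \<in> R. \<kappa> r = x} {c \<in> C. \<kappa>' c = x} f"
      by (rule Cons.prems(2)) simp
    show "represents ?D {r \<in> R. \<kappa> r \<in> set xs} {c \<in> C. \<kappa>' c \<in> set xs} f"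
      using Cons.prems by (intro Cons.IH) simp_all
  qed (use Cons.prems(1) in \<open>auto intro: assms(3)\<close>)
  moreover have "{r \<in> R. \<kappa> r \<in> set (x # xs)} = {r \<in> R. \<kappa> r = x} \<union> {r \<in> R. \<kappa> r \<in> set xs}"
    "{c \<in> C. \<kappa>' c \<in> set (x # xs)} = {c \<in> C. \<kappa>' c = x} \<union> {c \<in> C. \<kappa>' c \<in> set xs}"
    by auto
  ultimately show ?case
    by (simp only: list.map diag_block_mat.simps Let_def)
qed

section \<open>The matrices \<open>\<L>\<^sub>k\<close> as inclusion matrices\<close>

text \<open>Generalises \<open>idx_list\<close> to any ground list. Sublists containing the head
  come first; this order makes the recursion below an equality of matrices, not merely an
  equivalence.\<close>

definition combs :: "'b list \<Rightarrow> nat \<Rightarrow> 'b list list" where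
  "combs xs d = filter (\<lambda>\<alpha>. length \<alpha> = d) (subseqs xs)"

definition incl_mat :: "'b list \<Rightarrow> nat \<Rightarrow> 'a :: zero_neq_one mat" where
  "incl_mat xs d = mat (length (combs xs d)) (length (combs xs (Suc d)))
     (\<lambda>(i, j). if set (combs xs d ! i) \<subseteq> set (combs xs (Suc d) ! j) then 1 else 0)"

lemma combs_0: "combs xs 0 = [[]]"
  by (induction xs) (auto simp: combs_def Let_def filter_map o_def)

lemma combs_Nil_Suc: "combs [] (Suc d) = []"
  by (simp add: combs_def)

lemma combs_Cons_Suc: "combs (x # xs) (Suc d) = map ((#) x) (combs xs d) @ combs xs (Suc d)"
  by (simp add: combs_def Let_def filter_map o_def)

lemma length_combs: "length (combs xs d) = length xs choose d"
proof (induction xs arbitrary: d)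
  case Nil
  then show ?case by (cases d) (simp_all add: combs_0 combs_Nil_Suc)
next
  case (Cons x xs)
  then show ?case by (cases d) (simp_all add: combs_0 combs_Cons_Suc)
qed

lemma set_combs_subset: "\<alpha> \<in> set (combs xs d) \<Longrightarrow> set \<alpha> \<subseteq> set xs"
  using subseqs_powset[of xs] by (auto simp: combs_def)

lemma card_set_combs: "distinct xs \<Longrightarrow> \<alpha> \<in> set (combs xs d) \<Longrightarrow> card (set \<alpha>) = d"
  using subseqs_distinctD[of \<alpha> xs] by (auto simp: combs_def distinct_card simp del: in_set_subseqs)

lemma distinct_combs: "distinct xs \<Longrightarrow> distinct (combs xs d)"
  unfolding combs_def using distinct_set_subseqs[of xs]
  by (intro distinct_filter) (simp add: distinct_map)

lemma inj_on_set_combs: "distinct xs \<Longrightarrow> inj_on set (set (combs xs d))"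
  using distinct_set_subseqs[of xs] unfolding combs_def distinct_map
  by (auto intro: inj_on_subset)

lemma bij_betw_set_combs:
  assumes "distinct xs"
  shows "bij_betw set (set (combs xs d)) {S. S \<subseteq> set xs \<and> card S = d}"
  unfolding bij_betw_def
proof (intro conjI equalityI subsetI)
  fix S assume S: "S \<in> {S. S \<subseteq> set xs \<and> card S = d}"
  then obtain \<alpha> where "\<alpha> \<in> set (subseqs xs)" "S = set \<alpha>"
    using subset_subseqs by blast
  then show "S \<in> set ` set (combs xs d)"
    using S subseqs_distinctD[OF _ assms] by (force simp: combs_def distinct_card)
qed (use assms in \<open>auto simp: inj_on_set_combs card_set_combs dest: set_combs_subset\<close>)

lemma represents_incl_mat:
  assumes "distinct xs"
  shows "represents (incl_mat xs d :: 'a :: zero_neq_one mat)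
    {S. S \<subseteq> set xs \<and> card S = d} {T. T \<subseteq> set xs \<and> card T = Suc d}
    (\<lambda>S T. if S \<subseteq> T then 1 else 0)"
  unfolding incl_mat_def
  by (rule represents_reindex[OF represents_mat bij_betw_set_combs bij_betw_set_combs])
    (use assms in \<open>simp_all add: distinct_combs\<close>)

section \<open>The recursion for inclusion matrices, matched with that for
  \<open>A_mat\<close>\<close>

lemma dim_incl_mat:
  "dim_row (incl_mat xs d) = length xs choose d"
  "dim_col (incl_mat xs d) = length xs choose Suc d"
  by (simp_all add: incl_mat_def length_combs)

lemma append_rows_index:
  assumes "dim_col N = dim_col M" "i < dim_row M + dim_row N" "j < dim_col M"
  shows "(M @\<^sub>r N) $$ (i, j) = (if i < dim_row M then M $$ (i, j) else N $$ (i - dim_row M, j))"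
  using assms by (simp add: append_rows_def)

lemma dim_append_rows:
  "dim_row (M @\<^sub>r N) = dim_row M + dim_row N" "dim_col (M @\<^sub>r N) = dim_col M"
  by (simp_all add: append_rows_def)

text \<open>Split the subsets of \<open>x # xs\<close> into those containing \<open>x\<close>, which the enumeration lists first,
  and those avoiding \<open>x\<close>.\<close>

lemma incl_mat_Cons:
  assumes "distinct (x # xs)"
  shows "(incl_mat (x # xs) (Suc d) :: 'a :: zero_neq_one mat) =
    bottom_join (incl_mat xs d @\<^sub>r 1\<^sub>m (length xs choose Suc d)) (incl_mat xs (Suc d))"
    (is "?L = ?R")
proof (rule eq_matI)
  show dr: "dim_row ?L = dim_row ?R" and dc: "dim_col ?L = dim_col ?R"
    by (simp_all add: dim_incl_mat bottom_join_def dim_append_rows)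
  fix i j assume "i < dim_row ?R" "j < dim_col ?R"
  then have i: "i < (length xs choose d) + (length xs choose Suc d)"
    and j: "j < (length xs choose Suc d) + (length xs choose Suc (Suc d))"
    by (simp_all add: dim_incl_mat bottom_join_def dim_append_rows)
  let ?c = "combs xs"
  have mem: "?c e ! k \<in> set (?c e)" if "k < length xs choose e" for e k
    using that by (simp add: length_combs)
  have x: "x \<notin> set (?c e ! k)" if "k < length xs choose e" for e k
    using set_combs_subset[OF mem[OF that]] assms by auto
  \<comment> \<open>Between sets of equal size inclusion is equality; this produces the identity
    block.\<close>
  have eq: "set (?c (Suc d) ! k) \<subseteq> set (?c (Suc d) ! l) \<longleftrightarrow> k = l"
    if "k < length xs choose Suc d" "l < length xs choose Suc d" for k l
  proof
    assume "set (?c (Suc d) ! k) \<subseteq> set (?c (Suc d) ! l)"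
    then have "set (?c (Suc d) ! k) = set (?c (Suc d) ! l)"
      using card_set_combs[OF _ mem] that assms
      by (intro card_subset_eq) simp_all
    then have "?c (Suc d) ! k = ?c (Suc d) ! l"
      using inj_on_set_combs[of xs "Suc d"] mem that assms
      by (simp add: inj_on_def)
    then show "k = l"
      using distinct_combs[of xs "Suc d"] that assms
      by (simp add: nth_eq_iff_index_eq length_combs)
  qed simp
  show "?L $$ (i, j) = ?R $$ (i, j)"
  \<comment> \<open>Four quadrants: \<open>x\<close> in both sets cancels and leaves
    \<open>incl_mat xs d\<close>; \<open>x\<close> only in the column set gives the identity;
    \<open>x\<close> only in the row set gives zero; \<open>x\<close> in neither gives
    \<open>incl_mat xs (Suc d)\<close>.\<close>
  proof (cases "j < length xs choose Suc d")
    case True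
    then have R: "?R $$ (i, j) = (if i < length xs choose d then incl_mat xs d $$ (i, j)
        else 1\<^sub>m (length xs choose Suc d) $$ (i - (length xs choose d), j))"
      using i by (simp add: bottom_join_def dim_append_rows dim_incl_mat append_rows_index)
    have C: "set (combs (x # xs) (Suc (Suc d)) ! j) = insert x (set (?c (Suc d) ! j))"
      using True by (simp add: combs_Cons_Suc nth_append length_combs)
    show ?thesis
    proof (cases "i < length xs choose d")
      case i': True
      have "set (combs (x # xs) (Suc d) ! i) = insert x (set (?c d ! i))"
        using i' by (simp add: combs_Cons_Suc nth_append length_combs)
      then have "?L $$ (i, j) = incl_mat xs d $$ (i, j)"
        using i j i' True C x[OF i'] by (auto simp: incl_mat_def length_combs)
      then show ?thesis using R i' by simp
    next
      case i': False
      then have l: "i - (length xs choose d) < length xs choose Suc d" using i by simp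
      have "set (combs (x # xs) (Suc d) ! i) = set (?c (Suc d) ! (i - (length xs choose d)))"
        using i' by (simp add: combs_Cons_Suc nth_append length_combs)
      moreover have "x \<notin> set (?c (Suc d) ! (i - (length xs choose d)))"
        by (rule x[OF l])
      ultimately have "?L $$ (i, j) = (if i - (length xs choose d) = j then 1 else 0)"
        using i j C eq[OF l True]
        by (simp add: incl_mat_def length_combs subset_insert)
      then show ?thesis using R i' l True by simp
    qed
  next
    case False
    then have l: "j - (length xs choose Suc d) < length xs choose Suc (Suc d)" using j by simp
    have R: "?R $$ (i, j) = (if i < length xs choose d then 0
        else incl_mat xs (Suc d) $$ (i - (length xs choose d), j - (length xs choose Suc d)))"
      using i j False by (simp add: bottom_join_def dim_append_rows dim_incl_mat)
    have C: "set (combs (x # xs) (Suc (Suc d)) ! j) =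
        set (?c (Suc (Suc d)) ! (j - (length xs choose Suc d)))"
      using False by (simp add: combs_Cons_Suc nth_append length_combs)
    show ?thesis
    proof (cases "i < length xs choose d")
      case i': True
      have "set (combs (x # xs) (Suc d) ! i) = insert x (set (?c d ! i))"
        using i' by (simp add: combs_Cons_Suc nth_append length_combs)
      then have "?L $$ (i, j) = 0"
        using i j C x[OF l] by (auto simp: incl_mat_def length_combs)
      then show ?thesis using R i' by simp
    next
      case i': False
      then have "set (combs (x # xs) (Suc d) ! i) = set (?c (Suc d) ! (i - (length xs choose d)))"
        by (simp add: combs_Cons_Suc nth_append length_combs)
      then show ?thesis
        using R i' i j l C by (simp add: incl_mat_def length_combs)
    qed
  qed
qed

text \<open>For the end of the recursion: the remaining inclusion matrix has a row but no columns,
  while the empty join is \<open>0\<^sub>m 0 0\<close>; joining either changes nothing.\<close>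

lemma bottom_join_no_cols:
  assumes "dim_col N = 0"
  shows "bottom_join M N = M"
  using assms by (intro eq_matI) (auto simp: bottom_join_def)

text \<open>The only 0-subset is empty and lies in every singleton, hence the row of ones.\<close>

lemma D_mat_eq_incl_mat:
  "(D_mat (length xs) :: 'a :: field mat) = incl_mat xs 0 @\<^sub>r 1\<^sub>m (length xs choose Suc 0)"
proof -
  have "mat 1 (length xs) (\<lambda>_. 1) = (incl_mat xs 0 :: 'a mat)"
    by (rule eq_matI) (simp_all add: incl_mat_def length_combs combs_0)
  then show ?thesis by (simp add: D_mat_def)
qed

text \<open>Iterates \<open>incl_mat_Cons\<close>: the columns of each summand are the sets with a
  given first element. Keeping \<open>G\<close> abstract serves both clauses of
  \<open>A_mat\<close>, with \<open>D_mat\<close> as the case \<open>l = 0\<close>.\<close>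

lemma bottom_joins_eq_incl_mat:
  fixes xs :: "'b list"
  assumes "\<And>ys :: 'b list. distinct ys \<Longrightarrow> length ys > l \<Longrightarrow>
      G (length ys - l) = incl_mat ys l @\<^sub>r 1\<^sub>m (length ys choose Suc l)"
    and "distinct xs" "length xs = k + l + 1" "k \<ge> 1"
  shows "bottom_joins (map G (rev [1..<Suc k])) = (incl_mat xs (Suc l) :: 'a :: zero_neq_one mat)"
  using assms(2-)
proof (induction k arbitrary: xs)
  case (Suc k)
  from Suc.prems(2) obtain y ys where xs: "xs = y # ys"
    by (cases xs) auto
  have ys: "distinct ys" "length ys = k + l + 1" and dxs: "distinct (y # ys)"
    using Suc.prems xs by auto
  have "bottom_joins (map G (rev [1..<Suc (Suc k)])) =
      bottom_join (incl_mat ys l @\<^sub>r 1\<^sub>m (length ys choose Suc l))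
        (bottom_joins (map G (rev [1..<Suc k])))"
    using assms(1)[of ys] ys by (simp add: bottom_joins_def)
  also have "\<dots> = bottom_join (incl_mat ys l @\<^sub>r 1\<^sub>m (length ys choose Suc l)) (incl_mat ys (Suc l))"
  proof (cases "k = 0")
    case True
    then show ?thesis
      using ys(2) by (simp add: bottom_joins_def bottom_join_no_cols dim_incl_mat)
  next
    case False
    then show ?thesis using Suc.IH[of ys] ys by simp
  qed
  finally show ?case
    unfolding xs incl_mat_Cons[OF dxs] .
qed simp

text \<open>Removing first elements one by one yields the summands, which have a smaller first
  parameter and are inclusion matrices by induction on \<open>l\<close>; \<open>k\<close> and the
  list stay arbitrary there.\<close>

lemma A_mat_eq_incl_mat:
  fixes xs :: "'b list"
  assumes "distinct xs" "length xs = k + l + 1" "k \<ge> 1"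
  shows "(A_mat l k :: 'a :: field mat) = incl_mat xs (Suc l)"
  using assms
proof (induction l arbitrary: k xs)
  case 0
  show ?case
    unfolding A_mat.simps
    by (rule bottom_joins_eq_incl_mat) (use 0 in \<open>simp_all add: D_mat_eq_incl_mat\<close>)
next
  case (Suc l)
  show ?case
    unfolding A_mat.simps
  proof (rule bottom_joins_eq_incl_mat)
    fix ys :: "'b list" assume ys: "distinct ys" "length ys > Suc l"
    let ?j = "length ys - Suc l"
    have "(A_mat l ?j :: 'a mat) = incl_mat ys (Suc l)"
      by (rule Suc.IH) (use ys in simp_all)
    moreover have "?j + l + 1 = length ys" "l + 2 = Suc (Suc l)"
      using ys by simp_all
    ultimately show "(A_mat l ?j :: 'a mat) @\<^sub>r 1\<^sub>m ((?j + l + 1) choose (l + 2)) =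
        incl_mat ys (Suc l) @\<^sub>r 1\<^sub>m (length ys choose Suc (Suc l))"
      by (simp only:)
  qed (use Suc.prems in simp_all)
qed

text \<open>With \<open>l = s - 2\<close> and \<open>k = s + 1\<close> the ground set has
  \<open>k + l + 1 = 2 * s\<close> elements. The case \<open>s = 1\<close> is separate: one row for
  the empty set against two singletons.\<close>

lemma L_mat_eq_incl_mat:
  assumes "distinct xs" "length xs = 2 * s" "s \<ge> 1"
  shows "L_mat (Suc s) = incl_mat xs (s - 1)"
proof (cases "s = 1")
  case True
  then show ?thesis
    using assms by (intro eq_matI) (simp_all add: L_mat_def incl_mat_def length_combs combs_0)
next
  case False
  then have "A_mat (s - 2) (Suc s) = incl_mat xs (Suc (s - 2))"
    using assms by (intro A_mat_eq_incl_mat) simp_all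
  moreover have "Suc (s - 2) = s - 1" "Suc s - 3 = s - 2" using False assms(3) by simp_all
  ultimately show ?thesis using False by (simp add: L_mat_def)
qed

text \<open>Any set of \<open>2 * s\<close> elements may serve as ground set; below it is a set of
  free pairs.\<close>

lemma represents_L_mat:
  assumes "finite P" "card P = 2 * s" "s \<ge> 1"
  shows "represents (L_mat (Suc s)) {S. S \<subseteq> P \<and> card S = s - 1} {T. T \<subseteq> P \<and> card T = s}
    (\<lambda>S T. if S \<subseteq> T then 1 else 0)"
proof -
  obtain xs where xs: "set xs = P" "distinct xs"
    using finite_distinct_list[OF assms(1)] by blast
  then have len: "length xs = 2 * s"
    using assms(2) distinct_card by metis
  show ?thesis
    using represents_incl_mat[OF xs(2), of "s - 1"] assms(3)
    unfolding L_mat_eq_incl_mat[OF xs(2) len assms(3)] xs(1) by simp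
qed

section \<open>The block decomposition of \<open>B\<close>\<close>

definition lg_entry :: "nat \<Rightarrow> nat list \<Rightarrow> nat list \<Rightarrow> 'a :: field" where
  "lg_entry n \<alpha> \<beta> = (if \<exists>i\<in>{1..n}. {i} \<union> set \<alpha> \<union> {2*n - i + 1} = set \<beta> then 1 else 0)"

lemma lg_mat_eq: "lg_mat n =
  mat (length (idx_list (n - 2) (2*n))) (length (idx_list n (2*n)))
    (\<lambda>(p, q). lg_entry n (idx_list (n - 2) (2*n) ! p) (idx_list n (2*n) ! q))"
  by (simp add: lg_mat_def lg_entry_def length_idx_list)

lemma represents_lg_mat: "represents (lg_mat n) (idx (n - 2) (2*n)) (idx n (2*n)) (lg_entry n)"
  using represents_mat[OF distinct_idx_list distinct_idx_list]
  by (simp add: lg_mat_eq set_idx_list)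

lemma represents_L_block:
  "represents (L_block n a) {\<alpha> \<in> idx (n - 2) (2*n). unpaired n \<alpha> = a}
    {\<beta> \<in> idx n (2*n). unpaired n \<beta> = a} (lg_entry n)"
  using represents_submatrix[OF distinct_idx_list distinct_idx_list]
  by (simp add: L_block_def lg_mat_eq set_idx_list)

text \<open>Superscripts of all lengths at once, including the empty one, which belongs to the
  summand \<open>L_mat r\<close>.\<close>

definition unpaired_label :: "nat \<Rightarrow> nat list \<Rightarrow> bool" where
  "unpaired_label n a \<longleftrightarrow> sorted_wrt (<) a \<and> set a \<subseteq> {1..2*n} \<and>
     (\<forall>x\<in>set a. \<forall>y\<in>set a. x + y \<noteq> 2*n + 1)"

text \<open>The pairs \<open>{x, 2 * n + 1 - x}\<close> avoiding \<open>a\<close>, each represented by its smaller element.\<close>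

definition free_pairs :: "nat \<Rightarrow> nat list \<Rightarrow> nat set" where
  "free_pairs n a = {x \<in> {1..n}. x \<notin> set a \<and> 2*n + 1 - x \<notin> set a}"

definition add_pairs :: "nat \<Rightarrow> nat list \<Rightarrow> nat set \<Rightarrow> nat set" where
  "add_pairs n a S = set a \<union> S \<union> (\<lambda>x. 2*n + 1 - x) ` S"

lemma set_labels: "set (labels n k) = {a. unpaired_label n a \<and> length a = 2*k}"
  by (auto simp: labels_def set_idx_list idx_def unpaired_label_def)

section \<open>Decomposition of a multi-index into its unpaired part and a set of pairs\<close>

lemma sorted_wrt_less_unique:
  fixes \<alpha> \<beta> :: "'b :: linorder list"
  assumes "sorted_wrt (<) \<alpha>" "sorted_wrt (<) \<beta>" "set \<alpha> = set \<beta>"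
  shows "\<alpha> = \<beta>"
  using assms by (auto simp: strict_sorted_iff intro: sorted_distinct_set_unique)

lemma sorted_unpaired: "\<alpha> \<in> idx d (2*n) \<Longrightarrow> sorted_wrt (<) (unpaired n \<alpha>)"
  by (simp add: unpaired_def idx_def sorted_wrt_filter)

lemma set_unpaired: "set (unpaired n \<alpha>) = {x \<in> set \<alpha>. 2*n + 1 - x \<notin> set \<alpha>}"
  by (auto simp: unpaired_def)

lemma unpaired_label_unpaired:
  assumes "\<alpha> \<in> idx d (2*n)"
  shows "unpaired_label n (unpaired n \<alpha>)"
proof -
  have False if "x \<in> set (unpaired n \<alpha>)" "y \<in> set (unpaired n \<alpha>)" "x + y = 2*n + 1" for x y
  proof -
    have "2*n + 1 - x = y" using that(3) by simp
    then show False using that by (auto simp: set_unpaired)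
  qed
  then show ?thesis
    using sorted_unpaired[OF assms] assms
    by (auto simp: unpaired_label_def set_unpaired idx_def)
qed

lemma finite_free_pairs: "finite (free_pairs n a)"
  by (simp add: free_pairs_def)

text \<open>\<open>?h\<close> sends an entry to the smaller element of its pair. It is injective on
  a label, where no two entries are partners, and the free pairs are the complement of its image in
  \<open>{1..n}\<close>.\<close>

lemma card_free_pairs:
  assumes "unpaired_label n a"
  shows "card (free_pairs n a) = n - length a"
proof -
  let ?h = "\<lambda>x. if x \<le> n then x else 2*n + 1 - x"
  have a: "x \<in> {1..2*n}" if "x \<in> set a" for x
    using assms that by (auto simp: unpaired_label_def)
  have na: "x + y \<noteq> 2*n + 1" if "x \<in> set a" "y \<in> set a" for x y
    using assms that by (auto simp: unpaired_label_def)
  have "inj_on ?h (set a)"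
  proof (rule inj_onI)
    fix x y assume "x \<in> set a" "y \<in> set a" "?h x = ?h y"
    then show "x = y" using a[of x] a[of y] na[of x y] by (auto split: if_splits)
  qed
  moreover have "length a = card (set a)"
    using assms by (simp add: unpaired_label_def strict_sorted_iff distinct_card)
  ultimately have "card (?h ` set a) = length a"
    by (simp only: card_image)
  moreover have "?h ` set a \<subseteq> {1..n}"
    using a by force
  moreover have "free_pairs n a = {1..n} - ?h ` set a"
  proof (intro equalityI subsetI)
    fix x assume "x \<in> {1..n} - ?h ` set a"
    then have x: "x \<in> {1..n}" "\<And>y. y \<in> set a \<Longrightarrow> ?h y \<noteq> x" by auto
    then have "\<not> 2*n + 1 - x \<le> n" "2*n + 1 - (2*n + 1 - x) = x" by auto
    then show "x \<in> free_pairs n a"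
      using x(1) x(2)[of x] x(2)[of "2*n + 1 - x"] unfolding free_pairs_def by force
  next
    fix x assume x: "x \<in> free_pairs n a"
    have "?h y \<noteq> x" if "y \<in> set a" for y
      using x that a[OF that] by (auto simp: free_pairs_def)
    then show "x \<in> {1..n} - ?h ` set a"
      using x by (auto simp: free_pairs_def)
  qed
  ultimately show ?thesis
    by (simp add: card_Diff_subset)
qed

text \<open>The three parts are disjoint: \<open>S\<close> lies in \<open>{1..n}\<close>, its mirror
  image above \<open>n\<close>, and both avoid \<open>a\<close> because \<open>S\<close> consists of
  free pairs.\<close>

lemma card_add_pairs:
  assumes "unpaired_label n a" "S \<subseteq> free_pairs n a"
  shows "card (add_pairs n a S) = length a + 2 * card S"
proof -
  let ?m = "\<lambda>x. 2*n + 1 - x"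
  have S: "finite S" "S \<subseteq> {1..n}" "S \<inter> set a = {}" "?m ` S \<inter> set a = {}"
    using assms(2) finite_subset[OF _ finite_free_pairs] by (auto simp: free_pairs_def)
  have "card (?m ` S) = card S"
    using S(2) by (intro card_image inj_onI) force
  moreover have "?m x \<notin> S" if "x \<in> S" for x
    using subsetD[OF S(2), of x] subsetD[OF S(2), of "?m x"] that by auto
  then have "S \<inter> ?m ` S = {}"
    by blast
  moreover have "card (set a) = length a"
    using assms(1) by (simp add: unpaired_label_def strict_sorted_iff distinct_card)
  moreover have "card (set a \<union> (S \<union> ?m ` S)) = card (set a) + card (S \<union> ?m ` S)"
    using S by (intro card_Un_disjoint) auto
  ultimately show ?thesis
    using S(1) by (simp add: add_pairs_def Un_assoc card_Un_disjoint)
qed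

lemma add_pairs_Int_free_pairs:
  assumes "S \<subseteq> free_pairs n a"
  shows "add_pairs n a S \<inter> free_pairs n a = S"
  using assms by (force simp: add_pairs_def free_pairs_def)

text \<open>An entry without partner is in the unpaired part. Otherwise it or its partner is at most
  \<open>n\<close> and represents a free pair contained in the multi-index.\<close>

lemma set_eq_add_pairs:
  assumes "\<alpha> \<in> idx d (2*n)"
  shows "set \<alpha> = add_pairs n (unpaired n \<alpha>) (set \<alpha> \<inter> free_pairs n (unpaired n \<alpha>))"
proof (intro equalityI subsetI)
  fix x assume x: "x \<in> set \<alpha>"
  then have r: "x \<in> {1..2*n}" using assms by (auto simp: idx_def)
  show "x \<in> add_pairs n (unpaired n \<alpha>) (set \<alpha> \<inter> free_pairs n (unpaired n \<alpha>))"
  proof (cases "2*n + 1 - x \<in> set \<alpha>")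
    case True
    \<comment> \<open>With truncated subtraction the reflection is an involution only up to
      \<open>2*n + 1\<close>.\<close>
    have m: "2*n + 1 - (2*n + 1 - x) = x" using r by auto
    show ?thesis
    proof (cases "x \<le> n")
      case True': True
      then show ?thesis
        using True x r m by (auto simp: add_pairs_def free_pairs_def set_unpaired)
    next
      case False
      have "2*n + 1 - x \<in> set \<alpha> \<inter> free_pairs n (unpaired n \<alpha>)"
        using False True x r m by (auto simp: free_pairs_def set_unpaired)
      then have "2*n + 1 - (2*n + 1 - x) \<in> add_pairs n (unpaired n \<alpha>) (set \<alpha> \<inter> free_pairs n (unpaired n \<alpha>))"
        unfolding add_pairs_def by blast
      then show ?thesis unfolding m .
    qed
  qed (use x in \<open>auto simp: add_pairs_def set_unpaired\<close>)
next
  fix x assume "x \<in> add_pairs n (unpaired n \<alpha>) (set \<alpha> \<inter> free_pairs n (unpaired n \<alpha>))"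
  then show "x \<in> set \<alpha>"
    by (auto simp: add_pairs_def free_pairs_def set_unpaired)
qed

lemma length_unpaired:
  assumes "\<alpha> \<in> idx d (2*n)"
  shows "d = length (unpaired n \<alpha>) + 2 * card (set \<alpha> \<inter> free_pairs n (unpaired n \<alpha>))"
  using card_add_pairs[OF unpaired_label_unpaired[OF assms],
      of "set \<alpha> \<inter> free_pairs n (unpaired n \<alpha>)"]
  unfolding set_eq_add_pairs[OF assms, symmetric] card_idx[OF assms] by simp

lemma length_unpaired_le:
  assumes "\<alpha> \<in> idx d (2*n)"
  shows "length (unpaired n \<alpha>) \<le> d"
  using length_unpaired[OF assms] by linarith

text \<open>Completed pairs contribute an even number of entries. For even \<open>n\<close> this
  leaves only labels of even length, hence the superscripts of length \<open>2*k\<close>.\<close>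

lemma even_length_unpaired:
  assumes "\<alpha> \<in> idx d (2*n)"
  shows "even (length (unpaired n \<alpha>)) \<longleftrightarrow> even d"
  using arg_cong[OF length_unpaired[OF assms], of even] by simp

text \<open>Adjoining whole free pairs neither gives an entry of \<open>a\<close> a partner nor
  leaves an adjoined entry without one.\<close>

lemma add_pairs_sorted_list:
  assumes a: "unpaired_label n a" and S: "S \<subseteq> free_pairs n a"
  defines "\<alpha> \<equiv> sorted_list_of_set (add_pairs n a S)"
  shows "set \<alpha> = add_pairs n a S" "\<alpha> \<in> idx (length a + 2 * card S) (2*n)" "unpaired n \<alpha> = a"
proof -
  let ?m = "\<lambda>x. 2*n + 1 - x"
  have "finite (add_pairs n a S)"
    using finite_subset[OF S finite_free_pairs] by (simp add: add_pairs_def)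
  then show set: "set \<alpha> = add_pairs n a S"
    by (simp add: \<alpha>_def)
  have "add_pairs n a S \<subseteq> {1..2*n}"
    using a S by (force simp: add_pairs_def unpaired_label_def free_pairs_def)
  then show idx: "\<alpha> \<in> idx (length a + 2 * card S) (2*n)"
    using card_add_pairs[OF a S] set
    by (simp add: idx_def \<alpha>_def)
  have as: "x \<in> {1..2*n}" "?m x \<notin> set a" if "x \<in> set a" for x
    using a that by (force simp: unpaired_label_def)+
  have "set (unpaired n \<alpha>) = set a"
  proof (intro equalityI subsetI)
    fix x assume x: "x \<in> set a"
    have mm: "?m (?m x) = x" using as(1)[OF x] by auto
    have "?m x \<notin> S"
      using S x mm by (auto simp: free_pairs_def)
    moreover have "?m x \<notin> ?m ` S"
    proof
      assume "?m x \<in> ?m ` S"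
      then obtain y where y: "y \<in> S" "?m x = ?m y" by blast
      then have "x = y" using S as(1)[OF x] by (force simp: free_pairs_def)
      then show False using S x y by (auto simp: free_pairs_def)
    qed
    ultimately show "x \<in> set (unpaired n \<alpha>)"
      using x as(2)[OF x] by (simp add: set_unpaired set add_pairs_def)
  next
    fix x assume x: "x \<in> set (unpaired n \<alpha>)"
    have "x \<notin> S"
      using x by (auto simp: set_unpaired set add_pairs_def)
    moreover have "x \<notin> ?m ` S"
    proof
      assume "x \<in> ?m ` S"
      then obtain y where y: "y \<in> S" "x = ?m y" by blast
      then have "?m x = y" using S by (force simp: free_pairs_def)
      then show False using x y(1) by (auto simp: set_unpaired set add_pairs_def)
    qed
    ultimately show "x \<in> set a"
      using x by (auto simp: set_unpaired set add_pairs_def)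
  qed
  then show "unpaired n \<alpha> = a"
    using sorted_unpaired[OF idx] a by (auto simp: unpaired_label_def intro: sorted_wrt_less_unique)
qed

text \<open>Fixing the unpaired part turns multi-indices into subsets of the free pairs, the labels
  of an inclusion matrix.\<close>

lemma bij_betw_add_pairs:
  assumes a: "unpaired_label n a"
  shows "bij_betw (\<lambda>S. sorted_list_of_set (add_pairs n a S))
    {S. S \<subseteq> free_pairs n a \<and> card S = d} {\<alpha> \<in> idx (length a + 2*d) (2*n). unpaired n \<alpha> = a}"
proof (rule bij_betw_byWitness[where f' = "\<lambda>\<alpha>. set \<alpha> \<inter> free_pairs n a"])
  show "\<forall>S\<in>{S. S \<subseteq> free_pairs n a \<and> card S = d}.
      set (sorted_list_of_set (add_pairs n a S)) \<inter> free_pairs n a = S"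
    using add_pairs_sorted_list(1)[OF a] add_pairs_Int_free_pairs by simp
  show "\<forall>\<alpha>\<in>{\<alpha> \<in> idx (length a + 2*d) (2*n). unpaired n \<alpha> = a}.
      sorted_list_of_set (add_pairs n a (set \<alpha> \<inter> free_pairs n a)) = \<alpha>"
  proof
    fix \<alpha> assume \<alpha>: "\<alpha> \<in> {\<alpha> \<in> idx (length a + 2*d) (2*n). unpaired n \<alpha> = a}"
    then have "set \<alpha> = add_pairs n a (set \<alpha> \<inter> free_pairs n a)"
      using set_eq_add_pairs by blast
    then show "sorted_list_of_set (add_pairs n a (set \<alpha> \<inter> free_pairs n a)) = \<alpha>"
      using \<alpha> by (metis (no_types, lifting) idx_def mem_Collect_eq
          sorted_list_of_set.idem_if_sorted_distinct strict_sorted_iff)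
  qed
  show "(\<lambda>S. sorted_list_of_set (add_pairs n a S)) ` {S. S \<subseteq> free_pairs n a \<and> card S = d}
      \<subseteq> {\<alpha> \<in> idx (length a + 2*d) (2*n). unpaired n \<alpha> = a}"
    using add_pairs_sorted_list(2,3)[OF a] by blast
  show "(\<lambda>\<alpha>. set \<alpha> \<inter> free_pairs n a) ` {\<alpha> \<in> idx (length a + 2*d) (2*n). unpaired n \<alpha> = a}
      \<subseteq> {S. S \<subseteq> free_pairs n a \<and> card S = d}"
    using length_unpaired by fastforce
qed

text \<open>Intersecting with the free pairs recovers \<open>S\<close> and \<open>T\<close>, so
  adjoining a pair forces inclusion. Conversely, \<open>T\<close> exceeds \<open>S\<close> by a
  single element, whose pair is the one to adjoin.\<close>

lemma lg_entry_add_pairs: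
  assumes a: "unpaired_label n a" and S: "S \<subseteq> free_pairs n a" and T: "T \<subseteq> free_pairs n a"
    and card: "card T = Suc (card S)"
  shows "lg_entry n (sorted_list_of_set (add_pairs n a S)) (sorted_list_of_set (add_pairs n a T)) =
    (if S \<subseteq> T then 1 else 0)"
proof -
  have "(\<exists>i\<in>{1..n}. {i} \<union> add_pairs n a S \<union> {2*n - i + 1} = add_pairs n a T) \<longleftrightarrow> S \<subseteq> T"
  proof
    assume "\<exists>i\<in>{1..n}. {i} \<union> add_pairs n a S \<union> {2*n - i + 1} = add_pairs n a T"
    then have "add_pairs n a S \<subseteq> add_pairs n a T" by blast
    then show "S \<subseteq> T"
      using add_pairs_Int_free_pairs[OF S] add_pairs_Int_free_pairs[OF T] by blast
  next
    assume ST: "S \<subseteq> T"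
    then have "card (T - S) = 1"
      using card finite_subset[OF S finite_free_pairs] by (simp add: card_Diff_subset)
    then obtain i where "T - S = {i}" by (rule card_1_singletonE)
    then have i: "T = insert i S" using ST by blast
    then have "i \<in> {1..n}" using T by (auto simp: free_pairs_def)
    \<comment> \<open>\<open>add_pairs\<close> and the entries of \<open>B\<close> write the partner
      differently; both agree since \<open>i\<close> is at most \<open>2*n\<close>.\<close>
    moreover from this have "2*n + 1 - i = 2*n - i + 1" by auto
    ultimately show "\<exists>i\<in>{1..n}. {i} \<union> add_pairs n a S \<union> {2*n - i + 1} = add_pairs n a T"
      unfolding i add_pairs_def by (intro bexI[of _ i]) auto
  qed
  then show ?thesis
    unfolding lg_entry_def add_pairs_sorted_list(1)[OF a S] add_pairs_sorted_list(1)[OF a T]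
    by simp
qed

text \<open>A label of length \<open>n - 2*s\<close> leaves \<open>2*s\<close> free pairs; rows fill
  \<open>s - 1\<close> of them and columns \<open>s\<close>.\<close>

lemma represents_L_mat_block:
  assumes a: "unpaired_label n a" and n: "n = length a + 2*s" and s: "s \<ge> 1"
  shows "represents (L_mat (Suc s)) {\<alpha> \<in> idx (n - 2) (2*n). unpaired n \<alpha> = a}
    {\<beta> \<in> idx n (2*n). unpaired n \<beta> = a} (lg_entry n)"
proof (rule represents_reindex[OF represents_L_mat[OF finite_free_pairs _ s]])
  have "n - 2 = length a + 2 * (s - 1)" using n s by simp
  then show "bij_betw (\<lambda>S. sorted_list_of_set (add_pairs n a S))
      {S. S \<subseteq> free_pairs n a \<and> card S = s - 1} {\<alpha> \<in> idx (n - 2) (2*n). unpaired n \<alpha> = a}"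
    using bij_betw_add_pairs[OF a] by simp
  show "bij_betw (\<lambda>S. sorted_list_of_set (add_pairs n a S))
      {T. T \<subseteq> free_pairs n a \<and> card T = s} {\<beta> \<in> idx n (2*n). unpaired n \<beta> = a}"
    using bij_betw_add_pairs[OF a, of s] n by simp
  show "card (free_pairs n a) = 2 * s"
    using card_free_pairs[OF a] n by simp
  fix S T
  assume "S \<in> {S. S \<subseteq> free_pairs n a \<and> card S = s - 1}"
    and "T \<in> {T. T \<subseteq> free_pairs n a \<and> card T = s}"
  then show "lg_entry n (sorted_list_of_set (add_pairs n a S))
      (sorted_list_of_set (add_pairs n a T)) = (if S \<subseteq> T then 1 else 0)"
    using s by (intro lg_entry_add_pairs[OF a]) simp_all
qed

text \<open>A nonzero entry means that one full pair is adjoined. Its two members are new and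
  partners of each other, so no other entry gains a partner.\<close>

lemma unpaired_eq_if_lg_entry:
  assumes n: "n \<ge> 2" and \<alpha>: "\<alpha> \<in> idx (n - 2) (2*n)" and \<beta>: "\<beta> \<in> idx n (2*n)"
    and e: "lg_entry n \<alpha> \<beta> \<noteq> 0"
  shows "unpaired n \<alpha> = unpaired n \<beta>"
proof -
  let ?m = "\<lambda>x. 2*n + 1 - x"
  obtain i where i: "i \<in> {1..n}" and "{i} \<union> set \<alpha> \<union> {2*n - i + 1} = set \<beta>"
    using e by (auto simp: lg_entry_def split: if_splits)
  moreover have "2*n - i + 1 = ?m i" using i by auto
  ultimately have \<beta>s: "set \<beta> = insert i (insert (?m i) (set \<alpha>))" by auto
  \<comment> \<open>One new element cannot raise the cardinality from \<open>n - 2\<close> to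
    \<open>n\<close>, so both \<open>i\<close> and its partner are missing from
    \<open>\<alpha>\<close>.\<close>
  have "card (insert x (set \<alpha>)) < n" for x
    using card_idx[OF \<alpha>] n by (auto simp: card_insert_if)
  then have "set \<beta> \<noteq> insert x (set \<alpha>)" for x
    using card_idx[OF \<beta>] by (metis less_irrefl)
  then have ni: "i \<notin> set \<alpha>" "?m i \<notin> set \<alpha>"
    unfolding \<beta>s by blast+
  have mm: "?m (?m x) = x" if "x \<in> set \<beta>" for x
    using that \<beta> by (force simp: idx_def)
  have "set (unpaired n \<alpha>) = set (unpaired n \<beta>)"
  proof (intro equalityI subsetI)
    fix x assume x: "x \<in> set (unpaired n \<alpha>)"
    then have x\<alpha>: "x \<in> set \<alpha>" "?m x \<notin> set \<alpha>" by (simp_all add: set_unpaired)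
    have "?m (?m x) = x" "?m (?m i) = i"
      using mm[of x] mm[of i] x\<alpha>(1) \<beta>s by blast+
    then have "?m x \<noteq> i" "?m x \<noteq> ?m i"
      using x\<alpha>(1) ni by metis+
    then show "x \<in> set (unpaired n \<beta>)"
      using x\<alpha> unfolding set_unpaired \<beta>s by blast
  next
    fix x assume "x \<in> set (unpaired n \<beta>)"
    then have x: "x \<in> set \<beta>" "?m x \<notin> set \<beta>" by (simp_all add: set_unpaired)
    have "?m (?m i) = i"
      using mm[of i] \<beta>s by blast
    then have "x \<noteq> i" "x \<noteq> ?m i"
      using x(2) \<beta>s by auto
    then show "x \<in> set (unpaired n \<alpha>)"
      using x unfolding set_unpaired \<beta>s by blast
  qed
  then show ?thesis
    using sorted_unpaired[OF \<alpha>] sorted_unpaired[OF \<beta>] sorted_wrt_less_unique by blast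
qed

text \<open>Such a multi-index chooses exactly one element of each of the \<open>n\<close> pairs;
  \<open>S\<close> records the pairs whose smaller element is chosen.\<close>

lemma card_all_unpaired: "card {\<beta> \<in> idx n (2*n). length (unpaired n \<beta>) = n} = 2 ^ n"
proof -
  let ?m = "\<lambda>x. 2*n + 1 - x"
  let ?h = "\<lambda>S. S \<union> ?m ` ({1..n} - S)"
  let ?C = "{\<beta> \<in> idx n (2*n). length (unpaired n \<beta>) = n}"
  have C: "\<beta> \<in> ?C \<longleftrightarrow> \<beta> \<in> idx n (2*n) \<and> (\<forall>x\<in>set \<beta>. ?m x \<notin> set \<beta>)" for \<beta>
  proof -
    have "length (unpaired n \<beta>) = length \<beta> \<longleftrightarrow> (\<forall>x\<in>set \<beta>. ?m x \<notin> set \<beta>)"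
      unfolding unpaired_def
      by (metis (no_types, lifting) filter_True length_filter_less nat_neq_iff)
    then show ?thesis by (auto simp: idx_def)
  qed
  have card: "card (?h S) = n" if "S \<subseteq> {1..n}" for S
  proof -
    have "card (?m ` ({1..n} - S)) = card ({1..n} - S)"
      by (intro card_image inj_onI) force
    moreover have "?m x \<notin> S" if "x \<in> {1..n}" for x
      using subsetD[OF \<open>S \<subseteq> {1..n}\<close>, of "?m x"] that by auto
    then have "S \<inter> ?m ` ({1..n} - S) = {}"
      by blast
    moreover have "finite S" "card S \<le> n"
      using that finite_subset card_mono[of "{1..n}" S] by auto
    ultimately show ?thesis
      using that by (simp add: card_Un_disjoint card_Diff_subset)
  qed
  have set: "set (sorted_list_of_set (?h S)) = ?h S" if "S \<subseteq> {1..n}" for S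
    using finite_subset[OF that] by simp
  have int: "?h S \<inter> {1..n} = S" if "S \<subseteq> {1..n}" for S
    using that by auto
  have "bij_betw (\<lambda>S. sorted_list_of_set (?h S)) (Pow {1..n}) ?C"
  proof (rule bij_betw_byWitness[where f' = "\<lambda>\<beta>. set \<beta> \<inter> {1..n}"])
    show "\<forall>S\<in>Pow {1..n}. set (sorted_list_of_set (?h S)) \<inter> {1..n} = S"
      using set int by simp
    show "\<forall>\<beta>\<in>?C. sorted_list_of_set (?h (set \<beta> \<inter> {1..n})) = \<beta>"
    proof
      fix \<beta> assume \<beta>: "\<beta> \<in> ?C"
      have "set \<beta> \<subseteq> ?h (set \<beta> \<inter> {1..n})"
      proof
        fix x assume x: "x \<in> set \<beta>"
        then have r: "x \<in> {1..2*n}" using \<beta> by (auto simp: idx_def)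
        show "x \<in> ?h (set \<beta> \<inter> {1..n})"
        proof (cases "x \<le> n")
          case False
          then have "?m x \<in> {1..n} - (set \<beta> \<inter> {1..n})" "x = ?m (?m x)"
            using \<beta> x r C by auto
          then show ?thesis by blast
        qed (use x r in auto)
      qed
      then have "set \<beta> = ?h (set \<beta> \<inter> {1..n})"
        using \<beta> card_idx[of \<beta> n "2*n"] card[of "set \<beta> \<inter> {1..n}"]
        by (intro card_subset_eq) auto
      then show "sorted_list_of_set (?h (set \<beta> \<inter> {1..n})) = \<beta>"
        using \<beta> by (metis (no_types, lifting) idx_def mem_Collect_eq
            sorted_list_of_set.idem_if_sorted_distinct strict_sorted_iff)
    qed
    show "(\<lambda>S. sorted_list_of_set (?h S)) ` Pow {1..n} \<subseteq> ?C"
    proof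
      fix \<beta> assume "\<beta> \<in> (\<lambda>S. sorted_list_of_set (?h S)) ` Pow {1..n}"
      then obtain S where S: "S \<subseteq> {1..n}" and \<beta>: "\<beta> = sorted_list_of_set (?h S)" by blast
      have s\<beta>: "set \<beta> = ?h S" unfolding \<beta> by (rule set[OF S])
      have "?h S \<subseteq> {1..2*n}" using S by force
      then have "\<beta> \<in> idx n (2*n)"
        using card[OF S] s\<beta> by (simp add: idx_def \<beta>)
      moreover have "?m x \<notin> set \<beta>" if "x \<in> set \<beta>" for x
      proof
        assume "?m x \<in> set \<beta>"
        then have "x \<in> ?h S" "?m x \<in> ?h S"
          using that unfolding s\<beta> by blast+
        \<comment> \<open>Partners cannot both be at most \<open>n\<close> or both above
          \<open>n\<close>. In the mixed cases the larger one would mirror an element both inside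
          and outside \<open>S\<close>.\<close>
        then consider "x \<in> S" "?m x \<in> S" | y where "x \<in> S" "y \<in> {1..n} - S" "?m x = ?m y"
          | y where "y \<in> {1..n} - S" "x = ?m y" "?m x \<in> S"
          | y z where "y \<in> {1..n}" "z \<in> {1..n}" "x = ?m y" "?m x = ?m z"
          by blast
        then show False
        proof cases
          case 1
          then show ?thesis using subsetD[OF S, of x] subsetD[OF S, of "?m x"] by auto
        next
          case (2 y)
          have "x \<le> n" "y \<le> n" using 2 S by auto
          then have "x = y" using 2(3) by simp
          then show ?thesis using 2 by simp
        qed auto
      qed
      ultimately show "\<beta> \<in> ?C" using C by blast
    qed
  qed auto
  from bij_betw_same_card[OF this] show ?thesis
    by (simp add: card_Pow)
qed

section \<open>Assembly of the direct sum\<close>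

lemma represents_no_rows:
  assumes "finite C"
  shows "represents (0\<^sub>m 0 (card C)) {} C f"
proof -
  obtain \<gamma> where "bij_betw \<gamma> {..<card C} C"
    using ex_bij_betw_nat_finite[OF assms] by (auto simp: atLeast0LessThan)
  then show ?thesis by (intro representsI[of "\<lambda>_. undefined" _ _ \<gamma>]) (auto simp: bij_betw_def)
qed

lemma distinct_concat_map:
  assumes "distinct ks" "\<And>k. k \<in> set ks \<Longrightarrow> distinct (f k)"
    and "\<And>j k. j \<in> set ks \<Longrightarrow> k \<in> set ks \<Longrightarrow> j \<noteq> k \<Longrightarrow> set (f j) \<inter> set (f k) = {}"
  shows "distinct (concat (map f ks))"
  using assms
proof (induction ks)
  case (Cons k ks)
  have "set (f k) \<inter> set (f j) = {}" if "j \<in> set ks" for j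
    using Cons.prems(1) Cons.prems(3)[of k j] that by auto
  moreover have "distinct (concat (map f ks))"
    using Cons by simp
  ultimately show ?case
    using Cons.prems(2)[of k] by auto
qed simp

theorem theorem3p1:
  fixes n r :: nat
  assumes "n \<ge> 4" and "even n" and "r = (n + 2) div 2"
  shows "(lg_mat n :: 'a :: field mat) \<cong>\<^sub>m
           diag_block_mat
             (L_mat r
              # concat (map (\<lambda>k. map (\<lambda>a. L_block n a) (labels n k)) [1..<r - 1])
              @ [0\<^sub>m 0 (2 ^ n)])
         \<and> (\<forall>k\<in>{1..r - 2}. \<forall>a\<in>set (labels n k).
              (L_block n a :: 'a mat) \<cong>\<^sub>m L_mat (r - k))"
proof (intro conjI ballI)
  obtain h where h: "n = 2*h" using assms(2) by (rule evenE)
  then have r: "r = Suc h" and h2: "h \<ge> 2" using assms by simp_all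
  let ?R = "idx (n - 2) (2*n)" and ?C = "idx n (2*n)"
  let ?f = "lg_entry n :: nat list \<Rightarrow> nat list \<Rightarrow> 'a"
  show "(L_block n a :: 'a mat) \<cong>\<^sub>m L_mat (r - k)" if k: "k \<in> {1..r - 2}" and a: "a \<in> set (labels n k)"
    for k a
  proof -
    have rk: "r - k = Suc (h - k)"
      using k r by auto
    \<comment> \<open>The label has \<open>2*k\<close> entries, and \<open>k\<close> is at most
      \<open>r - 2 = h - 1\<close>.\<close>
    have "unpaired_label n a" "n = length a + 2 * (h - k)" "h - k \<ge> 1"
      using k a h r h2 by (auto simp: set_labels)
    then have "represents (L_mat (r - k)) {\<alpha> \<in> ?R. unpaired n \<alpha> = a}
        {\<beta> \<in> ?C. unpaired n \<beta> = a} ?f"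
      unfolding rk by (rule represents_L_mat_block)
    then show ?thesis
      using represents_L_block by (intro mat_equiv_if_represents)
  qed
  \<comment> \<open>\<open>None\<close> marks the columns with nothing but unpaired entries, which no row meets.\<close>
  define \<kappa> where "\<kappa> = (\<lambda>\<alpha>. Some (unpaired n \<alpha>))"
  define \<kappa>' where "\<kappa>' = (\<lambda>\<beta>. if length (unpaired n \<beta>) = n then None else Some (unpaired n \<beta>))"
  \<comment> \<open>The empty label carries \<open>L_mat r\<close> itself, the form in which the
    decomposition names that summand.\<close>
  define M :: "nat list option \<Rightarrow> 'a mat" where
    "M = (\<lambda>x. case x of None \<Rightarrow> 0\<^sub>m 0 (2 ^ n) | Some a \<Rightarrow> if a = [] then L_mat r else L_block n a)"
  define ls where "ls = concat (map (\<lambda>k. map Some (labels n k)) [1..<r - 1])"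
  define xs where "xs = Some [] # ls @ [None]"
  \<comment> \<open>The range of \<open>k\<close> covers exactly the even lengths from 2 to
    \<open>n - 2\<close>.\<close>
  have ls: "set ls = {Some a |a. unpaired_label n a \<and> a \<noteq> [] \<and> even (length a) \<and> length a < n}"
  proof (intro equalityI subsetI)
    fix x assume "x \<in> set ls"
    then obtain k a where "k \<in> {1..<r - 1}" "a \<in> set (labels n k)" "x = Some a"
      unfolding ls_def by auto
    then show "x \<in> {Some a |a. unpaired_label n a \<and> a \<noteq> [] \<and> even (length a) \<and> length a < n}"
      using h r by (auto simp: set_labels)
  next
    fix x assume "x \<in> {Some a |a. unpaired_label n a \<and> a \<noteq> [] \<and> even (length a) \<and> length a < n}"
    then obtain a k where a: "x = Some a" "unpaired_label n a" "a \<noteq> []" "length a < n"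
      "length a = 2*k" by (auto elim: evenE)
    then have "k \<in> {1..<r - 1}" "a \<in> set (labels n k)"
      using h r by (cases k; simp add: set_labels)+
    then show "x \<in> set ls"
      unfolding ls_def a(1) by auto
  qed
  \<comment> \<open>Rows have \<open>n - 2\<close> entries, so their unpaired parts are shorter than
    \<open>n\<close>; a column sharing one is not sent to \<open>None\<close>.\<close>
  have len_R: "length (unpaired n \<alpha>) < n" "even (length (unpaired n \<alpha>))" if "\<alpha> \<in> ?R" for \<alpha>
    using length_unpaired_le[OF that] even_length_unpaired[OF that] h h2 by simp_all
  have len_C: "even (length (unpaired n \<beta>))" "length (unpaired n \<beta>) \<le> n" if "\<beta> \<in> ?C" for \<beta>
    using length_unpaired_le[OF that] even_length_unpaired[OF that] h by simp_all
  have "represents (diag_block_mat (map M xs)) {\<alpha> \<in> ?R. \<kappa> \<alpha> \<in> set xs} {\<beta> \<in> ?C. \<kappa>' \<beta> \<in> set xs} ?f"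
  proof (rule represents_diag_block_mat)
    have "distinct ls"
      unfolding ls_def
      by (rule distinct_concat_map)
        (auto simp: set_labels distinct_map labels_def distinct_idx_list idx_def set_idx_list)
    then show "distinct xs"
      using ls by (auto simp: xs_def)
    show "?f \<alpha> \<beta> = 0" if "\<alpha> \<in> ?R" "\<beta> \<in> ?C" "\<kappa> \<alpha> \<noteq> \<kappa>' \<beta>" for \<alpha> \<beta>
    proof (rule ccontr)
      assume "?f \<alpha> \<beta> \<noteq> 0"
      then have "unpaired n \<alpha> = unpaired n \<beta>"
        using unpaired_eq_if_lg_entry[OF _ that(1,2)] assms(1) by simp
      then show False
        using that(3) len_R[OF that(1)] by (simp add: \<kappa>_def \<kappa>'_def)
    qed
    show "represents (M x) {\<alpha> \<in> ?R. \<kappa> \<alpha> = x} {\<beta> \<in> ?C. \<kappa>' \<beta> = x} ?f" if "x \<in> set xs" for x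
    proof (cases x)
      case None
      have "{\<alpha> \<in> ?R. \<kappa> \<alpha> = x} = {}" by (simp add: \<kappa>_def None)
      moreover have "{\<beta> \<in> ?C. \<kappa>' \<beta> = x} = {\<beta> \<in> ?C. length (unpaired n \<beta>) = n}"
        by (auto simp: \<kappa>'_def None)
      moreover have "M x = 0\<^sub>m 0 (card {\<beta> \<in> ?C. length (unpaired n \<beta>) = n})"
        unfolding card_all_unpaired by (simp add: M_def None)
      ultimately show ?thesis
        by (simp only:) (rule represents_no_rows, simp add: finite_idx)
    next
      case (Some a)
      then have a: "unpaired_label n a" "length a < n"
        using that ls h h2 by (auto simp: xs_def unpaired_label_def)
      have eq: "{\<alpha> \<in> ?R. \<kappa> \<alpha> = x} = {\<alpha> \<in> ?R. unpaired n \<alpha> = a}"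
        "{\<beta> \<in> ?C. \<kappa>' \<beta> = x} = {\<beta> \<in> ?C. unpaired n \<beta> = a}"
        using a(2) by (auto simp: \<kappa>_def \<kappa>'_def Some)
      show ?thesis
      proof (cases "a = []")
        \<comment> \<open>All \<open>n = 2*h\<close> pairs are free, so this is the block for
          \<open>s = h\<close>.\<close>
        case True
        then have "M x = L_mat (Suc h)" by (simp add: M_def Some r)
        then show ?thesis
          unfolding eq using represents_L_mat_block[OF a(1), of h] True h h2 by simp
      next
        case False
        then have "M x = L_block n a" by (simp add: M_def Some)
        then show ?thesis
          unfolding eq using represents_L_block by simp
      qed
    qed
  qed
  \<comment> \<open>An unpaired part has even length at most \<open>n\<close>: it is empty, has a
    label in \<open>ls\<close>, or has length \<open>n\<close>. So the keys in \<open>xs\<close>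
    exhaust all rows and columns.\<close>
  moreover have "{\<alpha> \<in> ?R. \<kappa> \<alpha> \<in> set xs} = ?R"
    using len_R unpaired_label_unpaired ls by (auto simp: \<kappa>_def xs_def)
  moreover have "{\<beta> \<in> ?C. \<kappa>' \<beta> \<in> set xs} = ?C"
    using len_C unpaired_label_unpaired ls
    by (auto simp: \<kappa>'_def xs_def le_less)
  moreover have "map M xs = L_mat r
      # concat (map (\<lambda>k. map (\<lambda>a. L_block n a) (labels n k)) [1..<r - 1]) @ [0\<^sub>m 0 (2 ^ n)]"
  proof -
    have "map M ls = concat (map (\<lambda>k. map (\<lambda>a. L_block n a) (labels n k)) [1..<r - 1])"
      unfolding ls_def map_concat map_map
      by (rule arg_cong[of _ _ concat], rule map_cong)
        (auto simp: M_def set_labels)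
    then show ?thesis by (simp add: xs_def M_def)
  qed
  ultimately show "(lg_mat n :: 'a mat) \<cong>\<^sub>m diag_block_mat (L_mat r
      # concat (map (\<lambda>k. map (\<lambda>a. L_block n a) (labels n k)) [1..<r - 1]) @ [0\<^sub>m 0 (2 ^ n)])"
    using mat_equiv_if_represents[OF represents_lg_mat] by simp
qed

end
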